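(* Let $(\tilde y_i)_{i\le n}$ be the output of the Cluster-DP mechanism (described in the context) with parameters $\gamma\in[0,1/K]$, $\sigma\ge 0$, $\lambda\in[0,1)$, applied to the observed outcomes $y_i=y_i(z_i)$, and let $\hat\tau_Q$ be the estimator defined in the context. Then $$0\le \mathrm{Var}_{DP,\mathbf z}[\hat\tau_Q]-\mathrm{Var}_{\mathbf z}[\hat\tau_{\mathrm{No\text{-}DP}}]\le\left(\frac1{(1-\lambda)^2}-1\right)\sum_{a\in\{0,1\}}\phi_a+\sum_{a\in\{0,1\}}\sum_{c\in\mathcal{C}}\frac{n_c^2}{n^2}\frac{A(n_{a,c})}{n_{a,c}},$$ where $$\phi_a:=\sum_{c\in\mathcal{C}}\frac{n_c^2}{n^2}\frac{S^2(\vec y_c(a))}{n_{a,c}}$$ and, for $x>0$, $$A(x):=2K\left[\gamma+\frac\sigma x\left(e^{-\gamma x/\sigma}-e^{-x/\sigma}\right)\right]\left[2\|\mathsf y\|_\infty^2+\frac{3\|\mathsf y\|_\infty^2+(\lambda\sqrt K+1)^2\,\|\mathsf y\|_2^2\,(1-\lambda(K-1)\gamma)}{(1-\lambda)^2}\right].$$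
   Context: Setting. $\mathcal{Y}\subset\mathbb{R}$ is finite, $K=|\mathcal{Y}|$. There are $n$ units with fixed potential outcomes $y_i(0),y_i(1)\in\mathcal{Y}$, partitioned into a finite set $\mathcal{C}$ of clusters; $c_i$ is the cluster of unit $i$, and cluster $c$ has $n_c\ge2$ units. Fixed integers $n_{1,c},n_{0,c}\ge1$ satisfy $n_{1,c}+n_{0,c}=n_c$. The treatment assignment $\mathbf z\in\{0,1\}^n$ is random: within each cluster $c$, independently across clusters, a uniformly random subset of $n_{1,c}$ units is treated ($z_i=1$) and the other $n_{0,c}$ are controlled ($z_i=0$). The observed outcome is $y_i=y_i(z_i)$. Cluster-DP mechanism. For each $c\in\mathcal{C}$, $a\in\{0,1\}$: (1) For $y\in\mathcal{Y}$, let $\hat p_a(y|c)=|\{i:c_i=c,z_i=a,y_i=y\}|/n_{a,c}$ and $q_a(y|c)=\max\{\gamma,\min\{1,\hat p_a(y|c)+w\}\}$, where $w\sim\mathrm{Laplace}(\sigma/n_{a,c})$ is drawn independently for each $(a,c,y)$ and independently of $\mathbf z$. ($\mathrm{Laplace}(b)$ has density $\frac1{2b}e^{-|x|/b}$; for $b=0$ it is the point mass at $0$.) (2) If $\sum_y q_a(y|c)>1$ let $\zeta_y=q_a(y|c)-\gamma$ for all $y$; otherwise let $\zeta_y=1-q_a(y|c)$ for all $y$. Set $\tilde q_a(y|c)=q_a(y|c)+\frac{\zeta_y}{\sum_{y'}\zeta_{y'}}\bigl(1-\sum_{y'}q_a(y'|c)\bigr)$ (with $\tilde q_a=q_a$ if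 $\sum_y q_a(y|c)=1$). Then, independently for each unit $i$ given $\mathbf z$ and the $\tilde q$'s, $\tilde y_i$ is a draw from $\tilde q_{z_i}(\cdot|c_i)$ with probability $\lambda$, and equals $y_i$ with probability $1-\lambda$. Estimators. $Q_{c,a}\in\mathbb{R}^{K\times K}$, indexed by $\mathcal{Y}\times\mathcal{Y}$, is $Q_{c,a}[y',y]=(1-\lambda)\mathbf 1(y'=y)+\lambda\tilde q_a(y'|c)$. $\mathsf y=(y)_{y\in\mathcal{Y}}\in\mathbb{R}^K$ is the vector of all possible outcomes, and $\mathsf y^TQ^{-1}_{c,a}[\tilde y]=\sum_{y'\in\mathcal{Y}}y'\,Q^{-1}_{c,a}[y',\tilde y]$. Then $$\hat\tau_Q=\sum_{c\in\mathcal{C}}\frac{n_c}{n}\sum_{i\in c}\left(\mathsf y^TQ^{-1}_{c,z_i}[\tilde y_i]\frac{z_i}{n_{1,c}}-\mathsf y^TQ^{-1}_{c,z_i}[\tilde y_i]\frac{1-z_i}{n_{0,c}}\right),\qquad \hat\tau_{\mathrm{No\text{-}DP}}=\sum_{c\in\mathcal{C}}\frac{n_c}{n}\sum_{i\in c}\left(\frac{y_iz_i}{n_{1,c}}-\frac{y_i(1-z_i)}{n_{0,c}}\right).$$ $\mathrm{Var}_{\mathbf z}$ is variance over $\mathbf z$; $\mathrm{Var}_{DP,\mathbf z}$ is variance over both the mechanism's randomness and $\mathbf z$. Other notation. $\vec y_c(a)=(y_i(a))_{i:c_i=c}$. For $\vec u\in\mathbb{R}^d$, $d\ge 2$, $S^2(\vec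 u)=\frac1{d-1}\sum_{j}(u_j-\bar u)^2$ with $\bar u=\frac1d\sum_j u_j$. If $\sigma=0$, the term $\frac\sigma x(e^{-\gamma x/\sigma}-e^{-x/\sigma})$ is read as $0$. *)

theory Defs
  imports "HOL-Probability.Probability" "HOL-Real_Asymp.Real_Asymp"
begin

text \<open>
  Encoding.  The finite outcome set is presented by a finite type \<open>'k\<close> of outcome labels together
  with an injective map \<open>val :: 'k \<Rightarrow> real\<close>, so that the outcome set is \<open>range val\<close> and
  \<open>K = CARD('k)\<close>; vectors and matrices indexed by outcomes are then of type \<open>real ^ 'k\<close> and
  \<open>real ^ 'k ^ 'k\<close>.  Units and clusters are finite types \<open>'u\<close> and \<open>'c\<close>, and \<open>cl i\<close> is the cluster
  of unit \<open>i\<close>.  Arms are Booleans: \<open>True\<close> is treatment (1), \<open>False\<close> is control (0).  The label of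
  the potential outcome of unit \<open>i\<close> in arm \<open>a\<close> is \<open>y a i\<close>, and \<open>m a c\<close> is the prescribed number of
  units of cluster \<open>c\<close> in arm \<open>a\<close>.
\<close>

definition cluster :: "('u \<Rightarrow> 'c) \<Rightarrow> 'c \<Rightarrow> 'u set" where
  "cluster cl c = {i. cl i = c}"

definition treatment_pmf ::
  "('u::finite \<Rightarrow> 'c::finite) \<Rightarrow> (bool \<Rightarrow> 'c \<Rightarrow> nat) \<Rightarrow> ('u \<Rightarrow> bool) pmf" where
  "treatment_pmf cl m =
     map_pmf (\<lambda>T i. i \<in> T (cl i))
       (Pi_pmf UNIV {} (\<lambda>c. pmf_of_set {S. S \<subseteq> cluster cl c \<and> card S = m True c}))"

definition observed :: "(bool \<Rightarrow> 'u \<Rightarrow> 'k) \<Rightarrow> ('u \<Rightarrow> bool) \<Rightarrow> 'u \<Rightarrow> 'k" where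
  "observed y z i = y (z i) i"


subsection \<open>The Cluster-DP mechanism\<close>

definition laplace :: "real \<Rightarrow> real measure" where
  "laplace b =
     (if b = 0 then return borel 0
      else density lborel (\<lambda>x. ennreal (1 / (2 * b) * exp (- \<bar>x\<bar> / b))))"

definition noise ::
  "(bool \<Rightarrow> 'c \<Rightarrow> nat) \<Rightarrow> real \<Rightarrow> (bool \<times> 'c \<times> 'k \<Rightarrow> real) measure" where
  "noise m \<sigma> = (\<Pi>\<^sub>M (a, c, k)\<in>UNIV. laplace (\<sigma> / real (m a c)))"

definition emp_freq ::
  "('u \<Rightarrow> 'c) \<Rightarrow> (bool \<Rightarrow> 'c \<Rightarrow> nat) \<Rightarrow> (bool \<Rightarrow> 'u \<Rightarrow> 'k) \<Rightarrow> ('u \<Rightarrow> bool) \<Rightarrow>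
     bool \<Rightarrow> 'c \<Rightarrow> 'k \<Rightarrow> real" where
  "emp_freq cl m y z a c k =
     real (card {i. cl i = c \<and> z i = a \<and> observed y z i = k}) / real (m a c)"

definition noisy_freq ::
  "('u \<Rightarrow> 'c) \<Rightarrow> (bool \<Rightarrow> 'c \<Rightarrow> nat) \<Rightarrow> (bool \<Rightarrow> 'u \<Rightarrow> 'k) \<Rightarrow> real \<Rightarrow> ('u \<Rightarrow> bool) \<Rightarrow>
     (bool \<times> 'c \<times> 'k \<Rightarrow> real) \<Rightarrow> bool \<Rightarrow> 'c \<Rightarrow> 'k \<Rightarrow> real" where
  "noisy_freq cl m y \<gamma> z w a c k = max \<gamma> (min 1 (emp_freq cl m y z a c k + w (a, c, k)))"

definition renormalize :: "real \<Rightarrow> ('k::finite \<Rightarrow> real) \<Rightarrow> 'k \<Rightarrow> real" where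
  "renormalize \<gamma> q k =
     (let s = (\<Sum>k'\<in>UNIV. q k');
          \<zeta> = (\<lambda>k. if s > 1 then q k - \<gamma> else 1 - q k)
      in if s = 1 then q k else q k + \<zeta> k / (\<Sum>k'\<in>UNIV. \<zeta> k') * (1 - s))"

definition private_freq ::
  "('u \<Rightarrow> 'c) \<Rightarrow> (bool \<Rightarrow> 'c \<Rightarrow> nat) \<Rightarrow> (bool \<Rightarrow> 'u \<Rightarrow> 'k::finite) \<Rightarrow> real \<Rightarrow> ('u \<Rightarrow> bool) \<Rightarrow>
     (bool \<times> 'c \<times> 'k \<Rightarrow> real) \<Rightarrow> bool \<Rightarrow> 'c \<Rightarrow> 'k \<Rightarrow> real" where
  "private_freq cl m y \<gamma> z w a c = renormalize \<gamma> (noisy_freq cl m y \<gamma> z w a c)"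

definition release_unit :: "real \<Rightarrow> ('k \<Rightarrow> real) \<Rightarrow> 'k \<Rightarrow> 'k pmf" where
  "release_unit l q k = bind_pmf (bernoulli_pmf l) (\<lambda>b. if b then embed_pmf q else return_pmf k)"

definition release ::
  "('u::finite \<Rightarrow> 'c) \<Rightarrow> (bool \<Rightarrow> 'c \<Rightarrow> nat) \<Rightarrow> (bool \<Rightarrow> 'u \<Rightarrow> 'k::finite) \<Rightarrow> real \<Rightarrow> real \<Rightarrow>
     ('u \<Rightarrow> bool) \<Rightarrow> (bool \<times> 'c \<times> 'k \<Rightarrow> real) \<Rightarrow> ('u \<Rightarrow> 'k) pmf" where
  "release cl m y \<gamma> l z w =
     Pi_pmf UNIV undefined
       (\<lambda>i. release_unit l (private_freq cl m y \<gamma> z w (z i) (cl i)) (observed y z i))"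

text \<open>
  The joint law of the assignment, the Laplace noise and the released outcomes: the noise is
  independent of the assignment, and the released outcomes are drawn conditionally on both.
\<close>

definition joint_space ::
  "(bool \<Rightarrow> 'c \<Rightarrow> nat) \<Rightarrow> real \<Rightarrow>
     (('u \<Rightarrow> bool) \<times> (bool \<times> 'c \<times> 'k \<Rightarrow> real) \<times> ('u \<Rightarrow> 'k)) measure" where
  "joint_space m \<sigma> = count_space UNIV \<Otimes>\<^sub>M (noise m \<sigma> \<Otimes>\<^sub>M count_space UNIV)"

definition cluster_dp ::
  "('u::finite \<Rightarrow> 'c::finite) \<Rightarrow> (bool \<Rightarrow> 'c \<Rightarrow> nat) \<Rightarrow> (bool \<Rightarrow> 'u \<Rightarrow> 'k::finite) \<Rightarrow>
     real \<Rightarrow> real \<Rightarrow> real \<Rightarrow>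
     (('u \<Rightarrow> bool) \<times> (bool \<times> 'c \<times> 'k \<Rightarrow> real) \<times> ('u \<Rightarrow> 'k)) measure" where
  "cluster_dp cl m y \<gamma> \<sigma> l =
     bind (measure_pmf (treatment_pmf cl m)) (\<lambda>z.
       bind (noise m \<sigma>) (\<lambda>w.
         distr (measure_pmf (release cl m y \<gamma> l z w)) (joint_space m \<sigma>) (\<lambda>r. (z, w, r))))"


subsection \<open>Well-definedness of the joint law\<close>

text \<open>The Giry-monad \<^const>\<open>bind\<close> and \<^const>\<open>embed_pmf\<close> carry side conditions; they hold here.\<close>

lemma renormalize_nonneg:
  fixes q :: "'k::finite \<Rightarrow> real"
  assumes q: "\<And>k. \<gamma> \<le> q k" "\<And>k. 0 \<le> q k" "\<And>k. q k \<le> 1" and g: "0 \<le> \<gamma>" "\<gamma> \<le> 1 / real CARD('k)"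
  shows "0 \<le> renormalize \<gamma> q k" "(\<Sum>k\<in>UNIV. renormalize \<gamma> q k) = 1"
proof -
  define s where "s = (\<Sum>k\<in>UNIV. q k)"
  have K: "real CARD('k) > 0" by simp
  have Kg: "real CARD('k) * \<gamma> \<le> 1" using g K by (simp add: field_simps)
  consider "s = 1" | "s > 1" | "s < 1" by linarith
  then have "0 \<le> renormalize \<gamma> q k \<and> (\<Sum>k\<in>UNIV. renormalize \<gamma> q k) = 1"
  proof cases
    case 1
    then show ?thesis using q by (simp add: renormalize_def Let_def s_def[symmetric])
  next
    case 2
    define Z where "Z = (\<Sum>k\<in>UNIV. q k - \<gamma>)"
    have Z: "Z = s - real CARD('k) * \<gamma>" by (simp add: Z_def s_def sum_subtractf)
    have Zp: "Z > 0" "s - 1 \<le> Z" using Z Kg 2 by auto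
    have e: "renormalize \<gamma> q k = q k + (q k - \<gamma>) / Z * (1 - s)" for k
      using 2 by (simp add: renormalize_def Let_def s_def[symmetric] Z_def[symmetric])
    have "(q k - \<gamma>) * ((s - 1) / Z) \<le> (q k - \<gamma>) * 1"
      using Zp q(1)[of k] by (intro mult_left_mono) auto
    then have "0 \<le> renormalize \<gamma> q k" using g(1) by (simp add: e algebra_simps diff_divide_distrib add_divide_distrib)
    moreover have "(\<Sum>k\<in>UNIV. renormalize \<gamma> q k) = s + (\<Sum>k\<in>UNIV. q k - \<gamma>) / Z * (1 - s)"
      by (simp only: e sum.distrib s_def sum_distrib_right sum_divide_distrib)
    ultimately show ?thesis using Zp Z_def by simp
  next
    case 3
    define Z where "Z = (\<Sum>k\<in>UNIV. 1 - q k)"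
    have Z: "Z = real CARD('k) - s" by (simp add: Z_def s_def sum_subtractf)
    have "real CARD('k) \<ge> 1" by simp
    then have Zp: "Z > 0" using Z 3 by linarith
    have e: "renormalize \<gamma> q k = q k + (1 - q k) / Z * (1 - s)" for k
      using 3 by (simp add: renormalize_def Let_def s_def[symmetric] Z_def[symmetric])
    have "0 \<le> renormalize \<gamma> q k" using q(2)[of k] q(3)[of k] Zp 3 by (simp add: e)
    moreover have "(\<Sum>k\<in>UNIV. renormalize \<gamma> q k) = s + (\<Sum>k\<in>UNIV. 1 - q k) / Z * (1 - s)"
      by (simp only: e sum.distrib s_def sum_distrib_right sum_divide_distrib)
    ultimately show ?thesis using Zp Z_def by simp
  qed
  then show "0 \<le> renormalize \<gamma> q k" "(\<Sum>k\<in>UNIV. renormalize \<gamma> q k) = 1" by auto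
qed

lemma private_freq:
  fixes y :: "bool \<Rightarrow> 'u \<Rightarrow> 'k::finite"
  assumes g: "0 \<le> \<gamma>" "\<gamma> \<le> 1 / real CARD('k)"
  shows "0 \<le> private_freq cl m y \<gamma> z w a c k" "(\<Sum>k\<in>UNIV. private_freq cl m y \<gamma> z w a c k) = 1"
proof -
  have "1 / real CARD('k) \<le> 1" by (simp add: divide_le_eq Suc_le_eq)
  then have "\<gamma> \<le> 1" using g by linarith
  then show "0 \<le> private_freq cl m y \<gamma> z w a c k" "(\<Sum>k\<in>UNIV. private_freq cl m y \<gamma> z w a c k) = 1"
    unfolding private_freq_def using g
    by (auto intro!: renormalize_nonneg simp: noisy_freq_def)
qed

lemma pmf_draw:
  fixes y :: "bool \<Rightarrow> 'u \<Rightarrow> 'k::finite"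
  assumes g: "0 \<le> \<gamma>" "\<gamma> \<le> 1 / real CARD('k)"
  shows "pmf (embed_pmf (private_freq cl m y \<gamma> z w a c)) k = private_freq cl m y \<gamma> z w a c k"
proof (rule pmf_embed_pmf)
  show "(\<integral>\<^sup>+x. ennreal (private_freq cl m y \<gamma> z w a c x) \<partial>count_space UNIV) = 1"
    by (simp add: nn_integral_count_space_finite sum_ennreal[OF private_freq(1)[OF g]] private_freq(2)[OF g])
qed (rule private_freq(1)[OF g])

lemma prob_space_laplace: "b \<ge> 0 \<Longrightarrow> prob_space (laplace b)" "sets (laplace b) = sets borel"
proof -
  assume b: "b \<ge> 0"
  show "prob_space (laplace b)"
  proof (cases "b = 0")
    case True then show ?thesis by (simp add: laplace_def prob_space_return)
  next
    case False
    then have b: "b > 0" using b by simp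
    let ?f = "\<lambda>x. 1 / (2 * b) * exp (- \<bar>x\<bar> / b)"
    have P: "(\<integral>\<^sup>+x. ennreal (?f x) * indicator {0..} x \<partial>lborel) = ennreal (0 - (- (1/2) * exp (-0/b)))"
    proof (rule nn_integral_FTC_atLeast)
      show "((\<lambda>x. - (1/2) * exp (- x / b)) \<longlongrightarrow> 0) at_top" using b by real_asymp
      fix x :: real assume "0 \<le> x"
      then show "((\<lambda>x. - (1/2) * exp (- x / b)) has_real_derivative ?f x) (at x)"
        using b by (auto intro!: derivative_eq_intros)
    qed (use b in auto)
    have N: "(\<integral>\<^sup>+x. ennreal (?f x) * indicator {..<0} x \<partial>lborel) = (\<integral>\<^sup>+x. ennreal (?f x) * indicator {0..} x \<partial>lborel)"
    proof -
      have "(\<integral>\<^sup>+x. ennreal (?f x) * indicator {0..} x \<partial>lborel) = (\<integral>\<^sup>+x. ennreal (?f x) * indicator {0<..} x \<partial>lborel)"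
        using AE_lborel_singleton[of "0::real"]
        by (intro nn_integral_cong_AE, elim eventually_mono) (simp add: indicator_def)
      also have "\<dots> = (\<integral>\<^sup>+x. ennreal (?f (0 + (-1) *x)) * indicator {0<..} (0 + (-1)*x) \<partial>lborel)"
        using nn_integral_real_affine[of "\<lambda>x. ennreal (?f x) * indicator {0<..} x" "-1" 0] by simp
      also have "\<dots> = (\<integral>\<^sup>+x. ennreal (?f x) * indicator {..<0} x \<partial>lborel)"
        by (intro nn_integral_cong) (auto simp: indicator_def)
      finally show ?thesis by simp
    qed
    have "(\<integral>\<^sup>+x. ennreal (?f x) \<partial>lborel) = (\<integral>\<^sup>+x. ennreal (?f x) * indicator {0..} x + ennreal (?f x) * indicator {..<0} x \<partial>lborel)"
      by (intro nn_integral_cong) (auto simp: indicator_def)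
    also have "\<dots> = ennreal (1/2) + ennreal (1/2)"
      using N P by (subst nn_integral_add) auto
    also have "\<dots> = 1" by (subst ennreal_plus[symmetric]) auto
    finally show ?thesis using b
      by (intro prob_spaceI) (simp add: laplace_def emeasure_density)
  qed
qed (simp add: laplace_def)

lemma prob_space_noise: 
  assumes "\<sigma> \<ge> 0"
  shows "prob_space (noise m \<sigma>)"
   unfolding noise_def by (intro prob_space_PiM) (use assms in \<open>auto intro!: prob_space_laplace divide_nonneg_nonneg\<close>)

lemma noise_comp[measurable]: "(\<lambda>w. w j) \<in> borel_measurable (noise m \<sigma>)"
proof -
  have "(\<lambda>w. w j) \<in> noise m \<sigma> \<rightarrow>\<^sub>M (case j of (a,c,k) \<Rightarrow> laplace (\<sigma> / real (m a c)))"
    unfolding noise_def by (rule measurable_component_singleton) auto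
  also have "?this \<longleftrightarrow> ?thesis" by (subst measurable_cong_sets[OF refl, of _ borel]) (auto simp: prob_space_laplace split: prod.splits)
  finally show ?thesis .
qed

lemma private_meas[measurable]:
 "(\<lambda>w. private_freq cl m y \<gamma> z w a c k) \<in> borel_measurable (noise m \<sigma>)"
  unfolding private_freq_def renormalize_def noisy_freq_def Let_def by measurable

lemma pmf_release: 
  fixes y :: "bool \<Rightarrow> 'u::finite \<Rightarrow> 'k::finite"
  assumes g: "0 \<le> \<gamma>" "\<gamma> \<le> 1 / real CARD('k)" and l: "0 \<le> l" "l < 1"
  shows "pmf (release cl m y \<gamma> l z w) r = (\<Prod>i\<in>UNIV. l * private_freq cl m y \<gamma> z w (z i) (cl i) (r i) + (1 - l) * of_bool (r i = observed y z i))"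
  unfolding release_def release_unit_def
  by (subst pmf_Pi) (use l in \<open>auto simp: pmf_bind pmf_draw[OF g] indicator_def intro!: prod.cong\<close>)

lemma release_meas:
  fixes y :: "bool \<Rightarrow> 'u::finite \<Rightarrow> 'k::finite" and cl :: "'u \<Rightarrow> 'c::finite"
  assumes g: "0 \<le> \<gamma>" "\<gamma> \<le> 1 / real CARD('k)" and l: "0 \<le> l" "l < 1"
  shows "(\<lambda>w. measure_pmf (release cl m y \<gamma> l z w)) \<in> noise m \<sigma> \<rightarrow>\<^sub>M prob_algebra (count_space UNIV)"
proof (intro measurable_prob_algebraI measurable_subprob_algebra)
  fix A :: "('u \<Rightarrow> 'k) set"
  have "emeasure (measure_pmf (release cl m y \<gamma> l z w)) A = (\<Sum>r\<in>A. ennreal (pmf (release cl m y \<gamma> l z w) r))" for w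
    by (subst emeasure_measure_pmf_finite) auto
  then show "(\<lambda>w. emeasure (measure_pmf (release cl m y \<gamma> l z w)) A) \<in> borel_measurable (noise m \<sigma>)"
    by (simp add: pmf_release[OF g l])
qed (auto simp: prob_space_measure_pmf prob_space_imp_subprob_space)

lemma cluster_dp_prob_space:
  fixes y :: "bool \<Rightarrow> 'u::finite \<Rightarrow> 'k::finite" and cl :: "'u \<Rightarrow> 'c::finite"
  assumes g: "0 \<le> \<gamma>" "\<gamma> \<le> 1 / real CARD('k)" and l: "0 \<le> l" "l < 1" and s: "0 \<le> \<sigma>"
  shows "prob_space (cluster_dp cl m y \<gamma> \<sigma> l)"
proof -
  note release_meas[OF g l, measurable]
  have 1: "(\<lambda>w. distr (measure_pmf (release cl m y \<gamma> l z w)) (joint_space m \<sigma>) (\<lambda>r. (z, w, r)))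
     \<in> noise m \<sigma> \<rightarrow>\<^sub>M prob_algebra (joint_space m \<sigma>)" for z
    unfolding joint_space_def by measurable
  have n: "noise m \<sigma> \<in> space (prob_algebra (noise m \<sigma>))" by (simp add: space_prob_algebra prob_space_noise s)
  have 2: "(noise m \<sigma> \<bind> (\<lambda>w. distr (measure_pmf (release cl m y \<gamma> l z w)) (joint_space m \<sigma>) (\<lambda>r. (z, w, r)))) \<in> space (prob_algebra (joint_space m \<sigma>))" for z
    using measurable_space[OF measurable_bind_prob_space[OF measurable_const[OF n] 1], of undefined "count_space UNIV"] by simp
  show ?thesis unfolding cluster_dp_def
    by (rule prob_space_bind'[where M="count_space UNIV" and N="joint_space m \<sigma>"])
      (use 2 in \<open>auto simp: space_prob_algebra prob_space_measure_pmf\<close>)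
qed


subsection \<open>Estimators\<close>

definition outcome_vec :: "('k \<Rightarrow> real) \<Rightarrow> real ^ 'k" where
  "outcome_vec val = (\<chi> k. val k)"

definition Q_matrix :: "real \<Rightarrow> ('k \<Rightarrow> real) \<Rightarrow> real ^ 'k ^ 'k" where
  "Q_matrix l q = (\<chi> k' k. (1 - l) * of_bool (k' = k) + l * q k')"

definition debiased :: "('k::finite \<Rightarrow> real) \<Rightarrow> real \<Rightarrow> ('k \<Rightarrow> real) \<Rightarrow> 'k \<Rightarrow> real" where
  "debiased val l q k = (\<Sum>k'\<in>UNIV. val k' * matrix_inv (Q_matrix l q) $ k' $ k)"

definition tau_Q ::
  "('u::finite \<Rightarrow> 'c::finite) \<Rightarrow> (bool \<Rightarrow> 'c \<Rightarrow> nat) \<Rightarrow> ('k::finite \<Rightarrow> real) \<Rightarrow> (bool \<Rightarrow> 'u \<Rightarrow> 'k) \<Rightarrow>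
     real \<Rightarrow> real \<Rightarrow> ('u \<Rightarrow> bool) \<times> (bool \<times> 'c \<times> 'k \<Rightarrow> real) \<times> ('u \<Rightarrow> 'k) \<Rightarrow> real" where
  "tau_Q cl m val y \<gamma> l = (\<lambda>(z, w, r).
     \<Sum>c\<in>UNIV. real (card (cluster cl c)) / real CARD('u) *
       (\<Sum>i\<in>cluster cl c.
          debiased val l (private_freq cl m y \<gamma> z w (z i) c) (r i) * of_bool (z i) / real (m True c)
        - debiased val l (private_freq cl m y \<gamma> z w (z i) c) (r i) * (1 - of_bool (z i))
            / real (m False c)))"

definition tau_no_dp ::
  "('u::finite \<Rightarrow> 'c::finite) \<Rightarrow> (bool \<Rightarrow> 'c \<Rightarrow> nat) \<Rightarrow> ('k \<Rightarrow> real) \<Rightarrow> (bool \<Rightarrow> 'u \<Rightarrow> 'k) \<Rightarrow>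
     ('u \<Rightarrow> bool) \<Rightarrow> real" where
  "tau_no_dp cl m val y z =
     (\<Sum>c\<in>UNIV. real (card (cluster cl c)) / real CARD('u) *
       (\<Sum>i\<in>cluster cl c.
          val (observed y z i) * of_bool (z i) / real (m True c)
        - val (observed y z i) * (1 - of_bool (z i)) / real (m False c)))"


subsection \<open>The terms of the variance bound\<close>

text \<open>Sample variance of a vector whose coordinates are indexed by the set \<open>I\<close>.\<close>

definition sample_var :: "'u set \<Rightarrow> ('u \<Rightarrow> real) \<Rightarrow> real" where
  "sample_var I u =
     1 / (real (card I) - 1) * (\<Sum>j\<in>I. (u j - (1 / real (card I)) * (\<Sum>j'\<in>I. u j'))\<^sup>2)"

definition phi ::
  "('u::finite \<Rightarrow> 'c::finite) \<Rightarrow> (bool \<Rightarrow> 'c \<Rightarrow> nat) \<Rightarrow> ('k \<Rightarrow> real) \<Rightarrow> (bool \<Rightarrow> 'u \<Rightarrow> 'k) \<Rightarrow>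
     bool \<Rightarrow> real" where
  "phi cl m val y a =
     (\<Sum>c\<in>UNIV. (real (card (cluster cl c)))\<^sup>2 / (real CARD('u))\<^sup>2 *
        (sample_var (cluster cl c) (\<lambda>i. val (y a i)) / real (m a c)))"

definition noise_term :: "real \<Rightarrow> real \<Rightarrow> real \<Rightarrow> real" where
  "noise_term \<gamma> \<sigma> x =
     (if \<sigma> = 0 then 0 else \<sigma> / x * (exp (- \<gamma> * x / \<sigma>) - exp (- x / \<sigma>)))"

text \<open>\<^const>\<open>infnorm\<close> is the maximum norm on \<open>real ^ 'k\<close>, and \<^const>\<open>norm\<close> the Euclidean norm.\<close>

definition A_fun :: "('k::finite \<Rightarrow> real) \<Rightarrow> real \<Rightarrow> real \<Rightarrow> real \<Rightarrow> real \<Rightarrow> real" where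
  "A_fun val \<gamma> \<sigma> l x =
     2 * real CARD('k) * (\<gamma> + noise_term \<gamma> \<sigma> x) *
     (2 * (infnorm (outcome_vec val))\<^sup>2 +
      (3 * (infnorm (outcome_vec val))\<^sup>2 +
       (l * sqrt (real CARD('k)) + 1)\<^sup>2 * (norm (outcome_vec val))\<^sup>2 *
         (1 - l * (real CARD('k) - 1) * \<gamma>))
      / (1 - l)\<^sup>2)"

end

theory Submission
  imports Defs
begin

text \<open>
  Since the private frequencies \<open>q\<close> sum to one, \<open>Q\<^sup>-\<^sup>1 = (I - \<lambda> q 1\<^sup>T) / (1 - \<lambda>)\<close> by Sherman-Morrison, so
  the estimator averages the affine corrections \<open>(v - \<lambda> \<mu>\<^sub>q) / (1 - \<lambda>)\<close> of the released outcomes, where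
  \<open>\<mu>\<^sub>q\<close> is the mean of \<open>q\<close>.  Conditionally on assignment and noise its mean is the non-private
  estimator; hence the excess variance is the mean conditional variance, which is nonnegative.

  If \<open>q\<close> were the empirical distribution \<open>p\<close> of an arm, the conditional variances in that arm
  would add up to \<open>\<lambda> (2 - \<lambda>) / (1 - \<lambda>)\<^sup>2 = 1 / (1 - \<lambda>)\<^sup>2 - 1\<close> times the sum of squared deviations,
  whose expectation under sampling without replacement is \<open>n\<^sub>a - 1\<close> times the population variance.
  Replacing \<open>p\<close> by \<open>q\<close> costs at most \<open>3 \<lambda> \<parallel>y\<parallel>\<^sup>2 \<parallel>q - p\<parallel>\<^sub>1 / (1 - \<lambda>)\<^sup>2\<close> per unit, in the maximum norm of
  \<open>y\<close>.  Renormalization at most doubles the distance to \<open>p\<close>, and clamping to \<open>[\<gamma>, 1]\<close> moves each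
  frequency by at most \<open>max \<gamma> (min 1 \<bar>w\<bar>)\<close>, whose mean is exactly \<open>\<gamma>\<close> plus the noise term.
  The remaining summands of \<open>A\<close> are slack.
\<close>

subsection \<open>The conditional variance in one arm\<close>

text \<open>\<open>matrix_inv\<close> is a Hilbert choice, so it is determined only once an inverse
  is known to exist. For square matrices a right inverse is also a left inverse, which makes
  \<open>B\<close> a two-sided inverse and therefore the chosen one.\<close>

lemma matrix_inv_eq:
  fixes A B :: "real ^ 'k ^ 'k"
  assumes "A ** B = mat 1"
  shows "matrix_inv A = B"
proof -
  have BA: "B ** A = mat 1" using assms matrix_left_right_inverse by blast
  have "\<exists>A'. A ** A' = mat 1 \<and> A' ** A = mat 1" using assms BA by blast
  then have "A ** matrix_inv A = mat 1" unfolding matrix_inv_def by (rule someI2_ex) simp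
  then show ?thesis using BA by (metis matrix_mul_assoc matrix_mul_lid matrix_mul_rid)
qed

text \<open>Sherman-Morrison: \<open>Q_matrix l q\<close> is a multiple of the identity plus the
  rank-one matrix \<open>l q 1^T\<close>, and total mass one of \<open>q\<close> makes the
  denominator \<open>1 - l + l\<close> equal to 1. Pairing with the outcomes turns the rank-one part
  of the inverse into the mean of \<open>q\<close>.\<close>

lemma debiased_eq:
  fixes val :: "'k::finite \<Rightarrow> real"
  assumes q: "(\<Sum>k\<in>UNIV. q k) = 1" and l: "l \<noteq> 1"
  shows "debiased val l q k = (val k - l * (\<Sum>k\<in>UNIV. val k * q k)) / (1 - l)"
proof -
  define B :: "real ^ 'k ^ 'k" where "B = (\<chi> k' k. (of_bool (k' = k) - l * q k') / (1 - l))"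
  have "Q_matrix l q ** B = mat 1"
  proof (simp add: vec_eq_iff matrix_matrix_mult_def mat_def Q_matrix_def B_def, intro allI conjI impI)
    have *: "(\<Sum>k\<in>UNIV. ((1 - l) * of_bool (i = k) + l * q i) * (of_bool (k = j) - l * q k) / (1 - l))
        = of_bool (i = j)" for i j
    proof -
      \<comment> \<open>The identity parts select k = i or k = j. The rank-one terms are left with
        coefficients \<open>- (1 - l) * l\<close>, \<open>l\<close> and \<open>- l * l\<close>,
        which cancel because \<open>q\<close> sums to one.\<close>
      have "(\<Sum>k\<in>UNIV. ((1 - l) * of_bool (i = k) + l * q i) * (of_bool (k = j) - l * q k))
          = (\<Sum>k\<in>UNIV. (if k = i then (1 - l) * of_bool (i = j) - (1 - l) * l * q i else 0)
               + (if k = j then l * q i else 0) - l * l * q i * q k)"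
        by (intro sum.cong) (auto simp: algebra_simps)
      also have "\<dots> = (1 - l) * of_bool (i = j) - (1 - l) * l * q i + l * q i - l * l * q i * (\<Sum>k\<in>UNIV. q k)"
        by (simp add: sum.distrib sum_subtractf sum_distrib_left)
      also have "\<dots> = (1 - l) * of_bool (i = j)"
        by (simp add: q algebra_simps)
      finally show ?thesis using l by (simp add: sum_divide_distrib[symmetric])
    qed
    show "(\<Sum>k\<in>UNIV. ((1 - l) * of_bool (i = k) + l * q i) * (of_bool (k = i) - l * q k) / (1 - l)) = 1" for i
      using *[of i i] by simp
    show "i \<noteq> j \<Longrightarrow> (\<Sum>k\<in>UNIV. ((1 - l) * of_bool (i = k) + l * q i) * (of_bool (k = j) - l * q k) / (1 - l)) = 0" for i j
      using *[of i j] by simp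
  qed
  then have "matrix_inv (Q_matrix l q) = B" by (rule matrix_inv_eq)
  then have "debiased val l q k = (\<Sum>k'\<in>UNIV. (val k' * of_bool (k' = k) - l * (val k' * q k')) / (1 - l))"
    unfolding debiased_def by (simp add: B_def algebra_simps)
  also have "\<dots> = (val k - l * (\<Sum>k\<in>UNIV. val k * q k)) / (1 - l)"
    by (simp add: sum_divide_distrib[symmetric] sum_subtractf sum_distrib_left[symmetric])
  finally show ?thesis .
qed

section \<open>Moments of a single released outcome\<close>

lemma expectation_release_unit:
  fixes q :: "'k::finite \<Rightarrow> real"
  assumes q: "\<And>k. 0 \<le> q k" "(\<Sum>k\<in>UNIV. q k) = 1" and l: "0 \<le> l" "l \<le> 1"
  shows "measure_pmf.expectation (release_unit l q k0) f = l * (\<Sum>k\<in>UNIV. f k * q k) + (1 - l) * f k0"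
proof -
  have "pmf (embed_pmf q) k = q k" for k
    by (rule pmf_embed_pmf)
       (auto simp: q nn_integral_count_space_finite sum_ennreal)
  then have pmf: "pmf (release_unit l q k0) k = l * q k + (1 - l) * of_bool (k = k0)" for k
    using l by (simp add: release_unit_def pmf_bind indicator_def)
  have "measure_pmf.expectation (release_unit l q k0) f = (\<Sum>k\<in>UNIV. f k * pmf (release_unit l q k0) k)"
    by (rule integral_measure_pmf_real) auto
  also have "\<dots> = (\<Sum>k\<in>UNIV. l * (f k * q k) + (1 - l) * (f k * of_bool (k = k0)))"
    by (intro sum.cong) (auto simp: pmf algebra_simps)
  also have "\<dots> = l * (\<Sum>k\<in>UNIV. f k * q k) + (1 - l) * f k0"
    by (simp add: sum.distrib sum_distrib_left[symmetric])
  finally show ?thesis .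
qed

lemma variance_pmf_finite:
  fixes p :: "'k::finite pmf" and f :: "'k \<Rightarrow> real"
  shows "measure_pmf.variance p f = measure_pmf.expectation p (\<lambda>k. (f k)\<^sup>2) - (measure_pmf.expectation p f)\<^sup>2"
  by (rule measure_pmf.variance_eq) (auto intro: integrable_measure_pmf_finite)

lemma variance_release_unit:
  fixes q :: "'k::finite \<Rightarrow> real"
  assumes q: "\<And>k. 0 \<le> q k" "(\<Sum>k\<in>UNIV. q k) = 1" and l: "0 \<le> l" "l \<le> 1"
  shows "measure_pmf.variance (release_unit l q k0) f =
    l * (\<Sum>k\<in>UNIV. (f k)\<^sup>2 * q k) + (1 - l) * (f k0)\<^sup>2 - (l * (\<Sum>k\<in>UNIV. f k * q k) + (1 - l) * f k0)\<^sup>2"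
  by (subst variance_pmf_finite) (simp only: expectation_release_unit[OF q l])

text \<open>Left undivided, so that a random arm consisting of a single unit is covered too, with
  value 0.\<close>

definition sum_sq_dev :: "'u set \<Rightarrow> ('u \<Rightarrow> real) \<Rightarrow> real" where
  "sum_sq_dev S x = (\<Sum>i\<in>S. (x i - (\<Sum>j\<in>S. x j) / real (card S))\<^sup>2)"

lemma sum_sq_dev_eq:
  assumes "finite S"
  shows "sum_sq_dev S x = (\<Sum>i\<in>S. (x i)\<^sup>2) - (\<Sum>i\<in>S. x i)\<^sup>2 / real (card S)"
proof (cases "S = {}")
  case False
  then have n: "real (card S) > 0" using assms by (simp add: card_gt_0_iff)
  define t where "t = (\<Sum>i\<in>S. x i)"
  have "sum_sq_dev S x = (\<Sum>i\<in>S. (x i)\<^sup>2 - 2 * (t / real (card S)) * x i + (t / real (card S))\<^sup>2)"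
    unfolding sum_sq_dev_def t_def[symmetric] by (intro sum.cong refl) (simp add: power2_diff)
  also have "\<dots> = (\<Sum>i\<in>S. (x i)\<^sup>2) - 2 * (t / real (card S)) * t + real (card S) * (t / real (card S))\<^sup>2"
    by (simp only: sum.distrib sum_subtractf sum_distrib_left[symmetric] t_def[symmetric] sum_constant)
  also have "\<dots> = (\<Sum>i\<in>S. (x i)\<^sup>2) - t\<^sup>2 / real (card S)"
    using n by (simp add: power2_eq_square)
  finally show ?thesis by (simp add: t_def)
qed (simp add: sum_sq_dev_def)

lemma sum_labels:
  fixes h :: "'u \<Rightarrow> 'k::finite" and f :: "'k \<Rightarrow> real"
  assumes "finite S"
  shows "(\<Sum>i\<in>S. f (h i)) = (\<Sum>k\<in>UNIV. f k * real (card {i \<in> S. h i = k}))"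
proof -
  have "(\<Sum>i\<in>S. f (h i)) = (\<Sum>k\<in>UNIV. \<Sum>i | i \<in> S \<and> h i = k. f (h i))"
    using sum.group[OF assms finite subset_UNIV, of "\<lambda>i. f (h i)" h] by simp
  also have "\<dots> = (\<Sum>k\<in>UNIV. f k * real (card {i \<in> S. h i = k}))"
    by (intro sum.cong refl) simp
  finally show ?thesis .
qed

text \<open>Summed over \<open>S\<close>, the mixture variances depend only on the first two moments
  of \<open>f\<close> under \<open>q\<close> and under the empirical distribution of the labels.
  These moments are Lipschitz in the l1 distance, with constants \<open>M\<close> and
  \<open>M\<^sup>2\<close>, so \<open>q\<close> can be exchanged for the empirical distribution at a
  controlled cost.\<close>

lemma sum_variance_release_unit_le:
  fixes q :: "'k::finite \<Rightarrow> real" and h :: "'u \<Rightarrow> 'k"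
  assumes q: "\<And>k. 0 \<le> q k" "(\<Sum>k\<in>UNIV. q k) = 1" and l: "0 \<le> l" "l \<le> 1"
    and S: "finite S" "S \<noteq> {}" and M: "\<And>k. \<bar>f k\<bar> \<le> M"
  shows "(\<Sum>i\<in>S. measure_pmf.variance (release_unit l q (h i)) f) \<le>
     l * (2 - l) * sum_sq_dev S (\<lambda>i. f (h i))
     + 3 * l * M\<^sup>2 * real (card S) * (\<Sum>k\<in>UNIV. \<bar>q k - real (card {i \<in> S. h i = k}) / real (card S)\<bar>)"
proof -
  define p where "p k = real (card {i \<in> S. h i = k}) / real (card S)" for k
  have n: "real (card S) > 0" using S by (simp add: card_gt_0_iff)
  have sp: "(\<Sum>i\<in>S. g (h i)) = real (card S) * (\<Sum>k\<in>UNIV. g k * p k)" for g :: "'k \<Rightarrow> real"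
    using n by (simp add: sum_labels[OF S(1)] p_def sum_distrib_left)
  define L where "L = (\<Sum>k\<in>UNIV. \<bar>q k - p k\<bar>)"
  have p1: "(\<Sum>k\<in>UNIV. p k) = 1" using sp[of "\<lambda>_. 1"] n by simp
  have p0: "p k \<ge> 0" for k by (simp add: p_def)
  have M0: "M \<ge> 0" using M[of undefined] by linarith
  have sq: "(f k)\<^sup>2 \<le> M\<^sup>2" for k using M[of k] by (simp add: abs_le_square_iff[symmetric])
  have lip: "\<bar>(\<Sum>k\<in>UNIV. g k * q k) - (\<Sum>k\<in>UNIV. g k * p k)\<bar> \<le> B * L" if "\<And>k. \<bar>g k\<bar> \<le> B" for g B
  proof -
    have "\<bar>(\<Sum>k\<in>UNIV. g k * q k) - (\<Sum>k\<in>UNIV. g k * p k)\<bar> = \<bar>\<Sum>k\<in>UNIV. g k * (q k - p k)\<bar>"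
      by (simp add: sum_subtractf right_diff_distrib)
    also have "\<dots> \<le> (\<Sum>k\<in>UNIV. \<bar>g k\<bar> * \<bar>q k - p k\<bar>)"
      by (rule order_trans[OF sum_abs]) (simp add: abs_mult)
    also have "\<dots> \<le> (\<Sum>k\<in>UNIV. B * \<bar>q k - p k\<bar>)"
      by (intro sum_mono mult_right_mono that) auto
    finally show ?thesis by (simp add: L_def sum_distrib_left)
  qed
  have mean: "\<bar>\<Sum>k\<in>UNIV. f k * r k\<bar> \<le> M" if "\<And>k. 0 \<le> r k" "(\<Sum>k\<in>UNIV. r k) = 1" for r
  proof -
    have "\<bar>\<Sum>k\<in>UNIV. f k * r k\<bar> \<le> (\<Sum>k\<in>UNIV. M * r k)"
      by (rule order_trans[OF sum_abs]) (auto simp: abs_mult that M intro!: sum_mono mult_right_mono)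
    then show ?thesis by (simp add: sum_distrib_left[symmetric] that)
  qed
  define a2 where "a2 = (\<Sum>k\<in>UNIV. (f k)\<^sup>2 * q k)"
  define b2 where "b2 = (\<Sum>k\<in>UNIV. (f k)\<^sup>2 * p k)"
  define a where "a = (\<Sum>k\<in>UNIV. f k * q k)"
  define b where "b = (\<Sum>k\<in>UNIV. f k * p k)"
  have d1: "\<bar>a - b\<bar> \<le> M * L" unfolding a_def b_def by (intro lip M)
  have d2: "\<bar>a2 - b2\<bar> \<le> M\<^sup>2 * L" unfolding a2_def b2_def by (intro lip) (simp add: sq)
  have ab: "\<bar>a\<bar> \<le> M" "\<bar>b\<bar> \<le> M" unfolding a_def b_def by (auto intro!: mean q p0 p1)
  have "(\<Sum>i\<in>S. measure_pmf.variance (release_unit l q (h i)) f)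
      = (\<Sum>i\<in>S. l * a2 - l\<^sup>2 * a\<^sup>2 + l * (1 - l) * (f (h i))\<^sup>2 - 2 * l * (1 - l) * a * f (h i))"
    unfolding variance_release_unit[OF q l] a_def a2_def
    by (intro sum.cong refl) (simp add: power2_eq_square algebra_simps)
  also have "\<dots> = real (card S) * (l * a2 - l\<^sup>2 * a\<^sup>2 + l * (1 - l) * b2 - 2 * l * (1 - l) * a * b)"
    by (simp add: sum.distrib sum_subtractf sum_distrib_left[symmetric] sp[of f] sp[of "\<lambda>k. (f k)\<^sup>2"]
        b_def b2_def algebra_simps)
  \<comment> \<open>The first summand is the value at equal moments, \<open>a = b\<close> and
    \<open>a2 = b2\<close>; the second is the exact remainder, with the factor \<open>a - b\<close>
    pulled out of its quadratic part.\<close>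
  also have "\<dots> = l * (2 - l) * (real (card S) * (b2 - b\<^sup>2))
      + real (card S) * l * ((a2 - b2) - (l * (a + b) + 2 * (1 - l) * b) * (a - b))"
    by (simp add: power2_eq_square algebra_simps)
  also have "\<dots> \<le> l * (2 - l) * (real (card S) * (b2 - b\<^sup>2)) + real (card S) * l * (3 * M\<^sup>2 * L)"
  proof -
    \<comment> \<open>The multiplier of \<open>a - b\<close> is a convex combination of
      \<open>a + b\<close> and \<open>2 * b\<close>, hence at most \<open>2 * M\<close> in absolute
      value. Together with the second moments this gives the constant 1 + 2 = 3.\<close>
    have "\<bar>l * (a + b) + 2 * (1 - l) * b\<bar> \<le> l * (2 * M) + 2 * (1 - l) * M"
    proof -
      have "\<bar>l * (a + b)\<bar> \<le> l * (2 * M)" using l ab by (simp add: abs_mult mult_left_mono)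
      moreover have "\<bar>2 * (1 - l) * b\<bar> \<le> 2 * (1 - l) * M" using l ab by (simp add: abs_mult mult_left_mono)
      ultimately show ?thesis by linarith
    qed
    then have "\<bar>l * (a + b) + 2 * (1 - l) * b\<bar> \<le> 2 * M" by (simp add: algebra_simps)
    then have "\<bar>(l * (a + b) + 2 * (1 - l) * b) * (a - b)\<bar> \<le> (2 * M) * (M * L)"
      unfolding abs_mult using d1 M0 by (intro mult_mono) auto
    then have "(a2 - b2) - (l * (a + b) + 2 * (1 - l) * b) * (a - b) \<le> 3 * M\<^sup>2 * L"
      using d2 by (simp add: power2_eq_square)
    then show ?thesis using l n by (intro add_left_mono mult_left_mono) auto
  qed
  also have "real (card S) * (b2 - b\<^sup>2) = sum_sq_dev S (\<lambda>i. f (h i))"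
    using n by (simp add: sum_sq_dev_eq[OF S(1)] sp[of f] sp[of "\<lambda>k. (f k)\<^sup>2"] b_def[symmetric] b2_def[symmetric]
        power_mult_distrib right_diff_distrib) (simp add: power2_eq_square)
  finally show ?thesis by (simp add: L_def p_def mult_ac)
qed

text \<open>The corrections all have the same sign and add up to at most the mass defect
  \<open>\<bar>1 - s\<bar>\<close>. As \<open>p\<close> has mass one, this defect is itself at most
  the l1 distance from \<open>q\<close> to \<open>p\<close>, and the triangle inequality gives the
  factor 2.\<close>

lemma sum_abs_renormalize_le:
  fixes q :: "'k::finite \<Rightarrow> real"
  assumes q: "\<And>k. \<gamma> \<le> q k" "\<And>k. q k \<le> 1"
    and p: "(\<Sum>k\<in>UNIV. p k) = 1"
  shows "(\<Sum>k\<in>UNIV. \<bar>renormalize \<gamma> q k - p k\<bar>) \<le> 2 * (\<Sum>k\<in>UNIV. \<bar>q k - p k\<bar>)"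
proof -
  define s where "s = (\<Sum>k\<in>UNIV. q k)"
  have sd: "\<bar>1 - s\<bar> \<le> (\<Sum>k\<in>UNIV. \<bar>q k - p k\<bar>)"
  proof -
    have "\<bar>1 - s\<bar> = \<bar>\<Sum>k\<in>UNIV. q k - p k\<bar>" by (simp add: sum_subtractf p s_def)
    then show ?thesis by (simp add: sum_abs)
  qed
  have "(\<Sum>k\<in>UNIV. \<bar>renormalize \<gamma> q k - q k\<bar>) \<le> \<bar>1 - s\<bar>"
  proof (cases "s = 1")
    case False
    define z where "z k = (if s > 1 then q k - \<gamma> else 1 - q k)" for k
    have z0: "0 \<le> z k" for k using q[of k] by (simp add: z_def)
    then have Z0: "0 \<le> (\<Sum>k\<in>UNIV. z k)" by (rule sum_nonneg)
    have "(\<Sum>k\<in>UNIV. \<bar>renormalize \<gamma> q k - q k\<bar>) = (\<Sum>k\<in>UNIV. z k / (\<Sum>k\<in>UNIV. z k) * \<bar>1 - s\<bar>)"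
      using False z0 Z0 unfolding renormalize_def s_def[symmetric] Let_def z_def[symmetric]
      by (auto simp: abs_mult intro!: sum.cong)
    also have "\<dots> = (\<Sum>k\<in>UNIV. z k) / (\<Sum>k\<in>UNIV. z k) * \<bar>1 - s\<bar>"
      by (simp only: sum_distrib_right sum_divide_distrib)
    \<comment> \<open>The quotient is 1, or 0 if all weights vanish, since division by zero yields
      0.\<close>
    also have "\<dots> \<le> 1 * \<bar>1 - s\<bar>" by (intro mult_right_mono) auto
    finally show ?thesis by simp
  qed (simp add: renormalize_def s_def)
  then have "(\<Sum>k\<in>UNIV. \<bar>renormalize \<gamma> q k - q k\<bar>) + (\<Sum>k\<in>UNIV. \<bar>q k - p k\<bar>) \<le> 2 * (\<Sum>k\<in>UNIV. \<bar>q k - p k\<bar>)"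
    using sd by linarith
  moreover have "(\<Sum>k\<in>UNIV. \<bar>renormalize \<gamma> q k - p k\<bar>) \<le> (\<Sum>k\<in>UNIV. \<bar>renormalize \<gamma> q k - q k\<bar>) + (\<Sum>k\<in>UNIV. \<bar>q k - p k\<bar>)"
    unfolding sum.distrib[symmetric] by (intro sum_mono) linarith
  ultimately show ?thesis by linarith
qed

text \<open>Both \<open>p\<close> and the clamped value lie in [0, 1], and clamping never goes
  further than \<open>\<bar>w\<bar>\<close> from \<open>p\<close> except when the value is lifted to
  \<open>\<gamma>\<close> above \<open>p\<close>, where the distance is at most
  \<open>\<gamma>\<close>. The right-hand side is free of \<open>p\<close>, and its mean under
  Laplace noise has a closed form.\<close>

lemma abs_clamp_diff_le:
  fixes p w \<gamma> :: real
  assumes "0 \<le> p" "p \<le> 1" "0 \<le> \<gamma>" "\<gamma> \<le> 1"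
  shows "\<bar>max \<gamma> (min 1 (p + w)) - p\<bar> \<le> max \<gamma> (min 1 \<bar>w\<bar>)"
  using assms by (auto simp: max_def min_def abs_if)


subsection \<open>Sampling without replacement\<close>

text \<open>In this form a random \<open>S\<close> enters only through the events that two given
  units are both sampled.\<close>

lemma sum_sq_dev_pairs:
  assumes "finite S"
  shows "2 * real (card S) * sum_sq_dev S x = (\<Sum>i\<in>S. \<Sum>j\<in>S. (x i - x j)\<^sup>2)"
proof (cases "S = {}")
  case False
  then have n: "real (card S) > 0" using assms by (simp add: card_gt_0_iff)
  have "(\<Sum>i\<in>S. \<Sum>j\<in>S. (x i - x j)\<^sup>2)
      = (\<Sum>i\<in>S. real (card S) * (x i)\<^sup>2 + (\<Sum>j\<in>S. (x j)\<^sup>2) - 2 * x i * (\<Sum>j\<in>S. x j))"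
    by (simp only: power2_diff sum.distrib sum_subtractf sum_distrib_left sum_constant mult.assoc)
  also have "\<dots> = 2 * real (card S) * (\<Sum>i\<in>S. (x i)\<^sup>2) - 2 * (\<Sum>i\<in>S. x i)\<^sup>2"
    by (simp add: sum.distrib sum_subtractf sum_distrib_left[symmetric] sum_distrib_right[symmetric] power2_eq_square)
  also have "\<dots> = 2 * real (card S) * sum_sq_dev S x"
    using n by (simp add: sum_sq_dev_eq[OF assms] right_diff_distrib)
  finally show ?thesis ..
qed simp

lemma card_subsets_containing_pair:
  assumes C: "finite C" "i \<in> C" "j \<in> C" "i \<noteq> j" and k: "2 \<le> k"
  shows "card {S. S \<subseteq> C \<and> card S = k \<and> i \<in> S \<and> j \<in> S} = (card C - 2) choose (k - 2)"
proof -
  have "bij_betw (\<lambda>R. insert i (insert j R)) {R. R \<subseteq> C - {i, j} \<and> card R = k - 2}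
      {S. S \<subseteq> C \<and> card S = k \<and> i \<in> S \<and> j \<in> S}"
  proof (rule bij_betw_byWitness[where f' = "\<lambda>S. S - {i, j}"])
    show "(\<lambda>R. insert i (insert j R)) ` {R. R \<subseteq> C - {i, j} \<and> card R = k - 2}
        \<subseteq> {S. S \<subseteq> C \<and> card S = k \<and> i \<in> S \<and> j \<in> S}"
    proof (rule image_subsetI)
      fix R assume "R \<in> {R. R \<subseteq> C - {i, j} \<and> card R = k - 2}"
      then have R: "R \<subseteq> C - {i, j}" "card R = k - 2" by auto
      then have "finite R" "i \<notin> R" "j \<notin> R" using C finite_subset[of R C] by auto
      then show "insert i (insert j R) \<in> {S. S \<subseteq> C \<and> card S = k \<and> i \<in> S \<and> j \<in> S}" using C R k by auto
    qed
    show "(\<lambda>S. S - {i, j}) ` {S. S \<subseteq> C \<and> card S = k \<and> i \<in> S \<and> j \<in> S}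
        \<subseteq> {R. R \<subseteq> C - {i, j} \<and> card R = k - 2}"
      using C by (auto simp: card_Diff_subset)
  qed auto
  then have "card {S. S \<subseteq> C \<and> card S = k \<and> i \<in> S \<and> j \<in> S} = card {R. R \<subseteq> C - {i, j} \<and> card R = k - 2}"
    by (simp add: bij_betw_same_card)
  also have "\<dots> = (card C - 2) choose (k - 2)"
    using C by (subst n_subsets) (auto simp: card_Diff_subset numeral_2_eq_2)
  finally show ?thesis .
qed

text \<open>Deleting the pair from a sample leaves an arbitrary \<open>(k - 2)\<close>-subset of the
  other elements, so the probability is a quotient of two binomial coefficients.\<close>

lemma prob_pair_in_sample:
  assumes C: "finite C" "i \<in> C" "j \<in> C" "i \<noteq> j" and k: "1 \<le> k" "k \<le> card C"
  shows "measure_pmf.prob (pmf_of_set {S. S \<subseteq> C \<and> card S = k}) {S. i \<in> S \<and> j \<in> S}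
    = real k * (real k - 1) / (real (card C) * (real (card C) - 1))"
proof -
  let ?F = "{S. S \<subseteq> C \<and> card S = k}"
  have cF: "card ?F = card C choose k" using C(1) by (rule n_subsets)
  then have ne: "card ?F > 0" using k by simp
  have p: "measure_pmf.prob (pmf_of_set ?F) {S. i \<in> S \<and> j \<in> S}
      = real (card {S. S \<subseteq> C \<and> card S = k \<and> i \<in> S \<and> j \<in> S}) / real (card C choose k)"
    using ne unfolding card_gt_0_iff
    by (subst measure_pmf_of_set)
      (simp_all only: cF, auto intro!: arg_cong[where f=card] arg_cong2[where f="(/)"])
  have "card {i, j} \<le> card C" using C by (intro card_mono) auto
  then have N: "card C \<ge> 2" using C by simp
  show ?thesis
  proof (cases "k = 1")
    \<comment> \<open>Here the natural number \<open>k - 2\<close> is truncated to 0 and the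
      binomial count would give 1, whereas no singleton contains two distinct units.\<close>
    case True
    then have "{S. S \<subseteq> C \<and> card S = k \<and> i \<in> S \<and> j \<in> S} = {}"
      using C by (auto simp: card_1_singleton_iff)
    then have e: "card {S. S \<subseteq> C \<and> card S = k \<and> i \<in> S \<and> j \<in> S} = 0" by (simp only: card.empty)
    show ?thesis using p unfolding e by (simp add: True)
  next
    case False
    then have k2: "2 \<le> k" using k by simp
    obtain n where n: "card C = Suc (Suc n)" using le_Suc_ex[OF N] by auto
    obtain h where h: "k = Suc (Suc h)" using le_Suc_ex[OF k2] by auto
    define X Y Z where "X = (Suc n choose Suc h)" "Y = (n choose h)" "Z = (Suc (Suc n) choose Suc (Suc h))"
    \<comment> \<open>The absorption identity, used twice, relates the two binomials through
      \<open>X\<close>; working with products postpones division to the reals.\<close>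
    have XY: "Suc h * X = Suc n * Y" and ZX: "Suc (Suc h) * Z = Suc (Suc n) * X"
      unfolding X_Y_Z_def by (rule Suc_times_binomial)+
    have "Suc (Suc n) * Suc n * Y = Suc (Suc n) * (Suc h * X)" by (simp only: XY mult.assoc)
    also have "\<dots> = Suc h * (Suc (Suc n) * X)" by (simp only: mult_ac)
    also have "\<dots> = Suc h * (Suc (Suc h) * Z)" by (simp only: ZX)
    also have "\<dots> = Suc (Suc h) * Suc h * Z" by (simp only: mult_ac)
    finally have "real (Suc (Suc n)) * real (Suc n) * real Y = real (Suc (Suc h)) * real (Suc h) * real Z"
      unfolding of_nat_mult[symmetric] by (rule arg_cong)
    moreover have "real Z > 0" using k n h by (simp add: X_Y_Z_def del: binomial_Suc_Suc)
    ultimately have "real Y / real Z = real (Suc (Suc h)) * real (Suc h) / (real (Suc (Suc n)) * real (Suc n))"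
      by (simp add: frac_eq_eq mult_ac del: of_nat_Suc)
    then show ?thesis
      using p card_subsets_containing_pair[OF C k2] by (simp add: n h X_Y_Z_def del: binomial_Suc_Suc)
  qed
qed

lemma sample_var_sum_sq_dev: "sample_var C x = sum_sq_dev C x / (real (card C) - 1)"
  by (simp add: sample_var_def sum_sq_dev_def)

text \<open>Writing the deviations over pairs and taking expectations multiplies the pair sum over
  \<open>C\<close> by the pair probability. Hence the sampled sum divided by \<open>k - 1\<close> is
  unbiased for the sample variance of \<open>C\<close>; for \<open>k = 1\<close> both sides are
  0.\<close>

lemma expectation_sum_sq_dev:
  assumes C: "finite C" "2 \<le> card C" and k: "1 \<le> k" "k \<le> card C"
  shows "measure_pmf.expectation (pmf_of_set {S. S \<subseteq> C \<and> card S = k}) (\<lambda>S. sum_sq_dev S x)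
    = (real k - 1) * sample_var C x"
proof -
  let ?F = "{S. S \<subseteq> C \<and> card S = k}" and ?N = "real (card C)"
  define p where "p = pmf_of_set ?F"
  define D where "D = (\<Sum>i\<in>C. \<Sum>j\<in>C. (x i - x j)\<^sup>2)"
  have "card ?F > 0" using n_subsets[OF C(1), of k] k by simp
  then have F: "finite ?F" "?F \<noteq> {}" by (simp_all add: card_gt_0_iff)
  then have sp: "set_pmf p = ?F" by (simp add: p_def)
  have int: "integrable (measure_pmf p) f" for f :: "_ \<Rightarrow> real"
    by (rule integrable_measure_pmf_finite) (simp add: sp F del: Collect_conj_eq)
  have "measure_pmf.expectation p (\<lambda>S. 2 * real k * sum_sq_dev S x)
      = measure_pmf.expectation p (\<lambda>S. \<Sum>i\<in>C. \<Sum>j\<in>C. (x i - x j)\<^sup>2 * indicator {S. i \<in> S \<and> j \<in> S} S)"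
  proof (intro integral_cong_AE AE_pmfI)
    fix S assume "S \<in> set_pmf p"
    then have S: "S \<subseteq> C" "card S = k" "finite S" using sp C finite_subset by auto
    have "2 * real k * sum_sq_dev S x = (\<Sum>i\<in>S. \<Sum>j\<in>S. (x i - x j)\<^sup>2)"
      using sum_sq_dev_pairs[OF S(3), of x] S(2) by simp
    also have "\<dots> = (\<Sum>i\<in>C. if i \<in> S then \<Sum>j\<in>C. if j \<in> S then (x i - x j)\<^sup>2 else 0 else 0)"
      using S C by (simp add: sum.inter_restrict[symmetric] Int_absorb1)
    also have "\<dots> = (\<Sum>i\<in>C. \<Sum>j\<in>C. (x i - x j)\<^sup>2 * indicator {S. i \<in> S \<and> j \<in> S} S)"
      by (intro sum.cong refl) (auto intro!: sum.cong)
    finally show "2 * real k * sum_sq_dev S x = \<dots>" .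
  qed auto
  also have "\<dots> = (\<Sum>i\<in>C. \<Sum>j\<in>C. (x i - x j)\<^sup>2 * measure_pmf.prob p {S. i \<in> S \<and> j \<in> S})"
    by (simp add: Bochner_Integration.integral_sum int)
  also have "\<dots> = (\<Sum>i\<in>C. \<Sum>j\<in>C. (x i - x j)\<^sup>2 * (real k * (real k - 1) / (?N * (?N - 1))))"
  proof (intro sum.cong refl)
    fix i j assume "i \<in> C" "j \<in> C"
    \<comment> \<open>The pair probability is false for i = j, but there the squared difference is
      0.\<close>
    then show "(x i - x j)\<^sup>2 * measure_pmf.prob p {S. i \<in> S \<and> j \<in> S} = (x i - x j)\<^sup>2 * (real k * (real k - 1) / (?N * (?N - 1)))"
      using prob_pair_in_sample[OF C(1) _ _ _ k, of i j] by (cases "i = j") (auto simp: p_def)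
  qed
  also have "\<dots> = D * (real k * (real k - 1) / (?N * (?N - 1)))"
    by (simp only: D_def sum_distrib_right)
  also have "D = 2 * ?N * sum_sq_dev C x" using sum_sq_dev_pairs[OF C(1)] by (simp add: D_def)
  also have "2 * ?N * sum_sq_dev C x * (real k * (real k - 1) / (?N * (?N - 1)))
      = 2 * real k * ((real k - 1) * sample_var C x)"
    using C by (auto simp: sample_var_sum_sq_dev)
  finally have "2 * real k * measure_pmf.expectation p (\<lambda>S. sum_sq_dev S x) = 2 * real k * ((real k - 1) * sample_var C x)"
    by simp
  then show ?thesis using k by (simp add: p_def)
qed

section \<open>The arms of a cluster as uniformly random subsets\<close>

definition arm :: "('u \<Rightarrow> 'c) \<Rightarrow> ('u \<Rightarrow> bool) \<Rightarrow> bool \<Rightarrow> 'c \<Rightarrow> 'u set" where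
  "arm cl z a c = {i. cl i = c \<and> z i = a}"

text \<open>The treated set of one cluster is a marginal of the product law, hence uniform. The
  control set is its complement in the cluster, and complementation is a bijection between subsets
  of the two prescribed sizes, so it carries uniform to uniform.\<close>

lemma arm_pmf:
  fixes cl :: "'u::finite \<Rightarrow> 'c::finite"
  assumes m: "m True c + m False c = card (cluster cl c)"
  shows "map_pmf (\<lambda>z. arm cl z a c) (treatment_pmf cl m) = pmf_of_set {S. S \<subseteq> cluster cl c \<and> card S = m a c}"
proof -
  let ?F = "\<lambda>a c. {S. S \<subseteq> cluster cl c \<and> card S = m a c}"
  have ne: "?F True c \<noteq> {}"
    using obtain_subset_with_card_n[of "m True c" "cluster cl c"] m by auto
  have comp: "map_pmf (\<lambda>T. T c) (Pi_pmf UNIV {} (\<lambda>c. pmf_of_set (?F True c))) = pmf_of_set (?F True c)"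
    by (subst Pi_pmf_component) auto
  \<comment> \<open>The intersection makes the description of the arm exact for every family
    \<open>T\<close>, not only for those in the support.\<close>
  let ?g = "\<lambda>S. if a then S \<inter> cluster cl c else cluster cl c - S"
  have "map_pmf (\<lambda>z. arm cl z a c) (treatment_pmf cl m)
      = map_pmf ?g (map_pmf (\<lambda>T. T c) (Pi_pmf UNIV {} (\<lambda>c. pmf_of_set (?F True c))))"
    unfolding treatment_pmf_def map_pmf_comp arm_def cluster_def
    by (intro map_pmf_cong refl) auto
  also have "\<dots> = map_pmf ?g (pmf_of_set (?F True c))" by (simp only: comp)
  also have "\<dots> = pmf_of_set (?g ` ?F True c)"
    by (rule map_pmf_of_set_inj) (use ne in \<open>auto simp: inj_on_def\<close>)
  also have "?g ` ?F True c = ?F a c"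
  proof (cases a)
    case True then show ?thesis by (auto simp: image_iff Int_absorb2)
  next
    case False
    show ?thesis
    proof
      show "?g ` ?F True c \<subseteq> ?F a c" using False m by (auto simp: card_Diff_subset)
      show "?F a c \<subseteq> ?g ` ?F True c"
      proof
        fix S assume S: "S \<in> ?F a c"
        then have "cluster cl c - S \<in> ?F True c" "S = ?g (cluster cl c - S)"
          using False m by (auto simp: card_Diff_subset)
        then show "S \<in> ?g ` ?F True c" by blast
      qed
    qed
  qed
  finally show ?thesis .
qed

lemma card_arm:
  fixes cl :: "'u::finite \<Rightarrow> 'c::finite"
  assumes m: "m True c + m False c = card (cluster cl c)" and z: "z \<in> set_pmf (treatment_pmf cl m)"
  shows "card (arm cl z a c) = m a c"
proof -
  let ?F = "{S. S \<subseteq> cluster cl c \<and> card S = m a c}"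
  have "m a c \<le> card (cluster cl c)" using m by (cases a) auto
  then have "?F \<noteq> {}" using obtain_subset_with_card_n[of "m a c" "cluster cl c"] by auto
  then have "set_pmf (map_pmf (\<lambda>z. arm cl z a c) (treatment_pmf cl m)) = ?F"
    by (subst arm_pmf[where m=m, OF m]) (simp add: set_pmf_of_set)
  then show ?thesis using z by auto
qed

lemma expectation_sum_sq_dev_arm:
  fixes cl :: "'u::finite \<Rightarrow> 'c::finite"
  assumes m: "m True c + m False c = card (cluster cl c)" "1 \<le> m a c" and c: "2 \<le> card (cluster cl c)"
  shows "measure_pmf.expectation (treatment_pmf cl m) (\<lambda>z. sum_sq_dev (arm cl z a c) x)
    = (real (m a c) - 1) * sample_var (cluster cl c) x"
proof -
  have "measure_pmf.expectation (treatment_pmf cl m) (\<lambda>z. sum_sq_dev (arm cl z a c) x)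
    = measure_pmf.expectation (map_pmf (\<lambda>z. arm cl z a c) (treatment_pmf cl m)) (\<lambda>S. sum_sq_dev S x)"
    by simp
  also have "\<dots> = (real (m a c) - 1) * sample_var (cluster cl c) x"
    unfolding arm_pmf[where m=m, OF m(1)]
    by (rule expectation_sum_sq_dev) (use m c in \<open>cases a; auto\<close>)+
  finally show ?thesis .
qed


subsection \<open>The truncated Laplace noise\<close>

lemma emeasure_laplace_tail:
  assumes b: "0 < b" and t: "0 \<le> t"
  shows "emeasure (laplace b) {x. t \<le> \<bar>x\<bar>} = ennreal (exp (- t / b))"
proof -
  let ?f = "\<lambda>x. 1 / (2 * b) * exp (- \<bar>x\<bar> / b)"
  have P: "(\<integral>\<^sup>+x. ennreal (?f x) * indicator {t..} x \<partial>lborel) = ennreal (0 - (- (1/2) * exp (- t / b)))"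
  proof (rule nn_integral_FTC_atLeast)
    show "((\<lambda>x. - (1/2) * exp (- x / b)) \<longlongrightarrow> 0) at_top" using b by real_asymp
    fix x :: real assume "t \<le> x"
    then show "((\<lambda>x. - (1/2) * exp (- x / b)) has_real_derivative ?f x) (at x)"
      using b t by (auto intro!: derivative_eq_intros)
  qed (use b in auto)
  have N: "(\<integral>\<^sup>+x. ennreal (?f x) * indicator {..-t} x \<partial>lborel) = (\<integral>\<^sup>+x. ennreal (?f x) * indicator {t..} x \<partial>lborel)"
  proof -
    have "(\<integral>\<^sup>+x. ennreal (?f x) * indicator {t..} x \<partial>lborel)
        = (\<integral>\<^sup>+x. ennreal (?f (0 + (-1) * x)) * indicator {t..} (0 + (-1) * x) \<partial>lborel)"
      using nn_integral_real_affine[of "\<lambda>x. ennreal (?f x) * indicator {t..} x" "-1" 0] by simp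
    also have "\<dots> = (\<integral>\<^sup>+x. ennreal (?f x) * indicator {..-t} x \<partial>lborel)"
      by (intro nn_integral_cong) (auto simp: indicator_def)
    finally show ?thesis by simp
  qed
  have "emeasure (laplace b) {x. t \<le> \<bar>x\<bar>} = (\<integral>\<^sup>+x. ennreal (?f x) * indicator {x. t \<le> \<bar>x\<bar>} x \<partial>lborel)"
    using b by (simp add: laplace_def emeasure_density)
  \<comment> \<open>For \<open>t = 0\<close> the two half-lines overlap in the point 0, so the
    splitting holds only almost everywhere.\<close>
  also have "\<dots> = (\<integral>\<^sup>+x. ennreal (?f x) * indicator {t..} x + ennreal (?f x) * indicator {..-t} x \<partial>lborel)"
    using AE_lborel_singleton[of "0::real"] t
    by (intro nn_integral_cong_AE, elim eventually_mono) (auto simp: indicator_def abs_if)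
  also have "\<dots> = ennreal (1/2 * exp (- t / b)) + ennreal (1/2 * exp (- t / b))"
    using N P by (subst nn_integral_add) auto
  also have "\<dots> = ennreal (exp (- t / b))" by (subst ennreal_plus[symmetric]) auto
  finally show ?thesis .
qed

text \<open>The mean excess over \<open>\<gamma>\<close> is the integral over the levels t from
  \<open>\<gamma>\<close> to 1 of the tail probability \<open>exp (- t / b)\<close>, with
  \<open>b = \<sigma> / x\<close>; this is exactly \<open>noise_term\<close>. For
  \<open>\<sigma> = 0\<close> the noise is the point mass at 0 and the clamp equals
  \<open>\<gamma>\<close>.\<close>

lemma expectation_laplace_clamp:
  assumes g: "0 \<le> \<gamma>" "\<gamma> \<le> 1" and s: "0 \<le> \<sigma>" and x: "0 < x"
  shows "(\<integral>w. max \<gamma> (min 1 \<bar>w\<bar>) \<partial>laplace (\<sigma> / x)) = \<gamma> + noise_term \<gamma> \<sigma> x"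
proof (cases "\<sigma> = 0")
  case True
  then show ?thesis using g by (simp add: laplace_def noise_term_def integral_return)
next
  case False
  define b where "b = \<sigma> / x"
  have b: "b > 0" using False s x by (simp add: b_def)
  interpret prob_space "laplace b" using b by (intro prob_space_laplace) auto
  have [measurable_cong]: "sets (laplace b) = sets borel" by (rule prob_space_laplace)
  let ?u = "\<lambda>w. max \<gamma> (min 1 \<bar>w\<bar>) - \<gamma>"
  \<comment> \<open>Layer cake: \<open>?u w\<close> is the length of the set of levels \<open>t\<close> in \<open>[\<gamma>, 1]\<close> with \<open>t \<le> \<bar>w\<bar>\<close>.\<close>
  interpret P: pair_sigma_finite lborel "laplace b" ..
  have "(\<integral>\<^sup>+w. ennreal (?u w) \<partial>laplace b)
      = (\<integral>\<^sup>+w. (\<integral>\<^sup>+t. indicator {\<gamma>..1} t * indicator {t. t \<le> \<bar>w\<bar>} t \<partial>lborel) \<partial>laplace b)"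
  proof (intro nn_integral_cong)
    fix w :: real
    have "(\<integral>\<^sup>+t. indicator {\<gamma>..1} t * indicator {t. t \<le> \<bar>w\<bar>} t \<partial>lborel) = (\<integral>\<^sup>+t. indicator {\<gamma>..min 1 \<bar>w\<bar>} t \<partial>lborel)"
      by (intro nn_integral_cong) (auto simp: indicator_def)
    also have "\<dots> = ennreal (?u w)"
      by (auto simp: emeasure_lborel_Icc_eq max_def)
    finally show "ennreal (?u w) = (\<integral>\<^sup>+t. indicator {\<gamma>..1} t * indicator {t. t \<le> \<bar>w\<bar>} t \<partial>lborel)" by simp
  qed
  also have "\<dots> = (\<integral>\<^sup>+t. (\<integral>\<^sup>+w. indicator {\<gamma>..1} t * indicator {t. t \<le> \<bar>w\<bar>} t \<partial>laplace b) \<partial>lborel)"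
    by (rule P.Fubini') (simp add: indicator_def)
  also have "\<dots> = (\<integral>\<^sup>+t. ennreal (exp (- t / b)) * indicator {\<gamma>..1} t \<partial>lborel)"
  proof (intro nn_integral_cong)
    fix t :: real
    have "{w \<in> space borel. t \<le> \<bar>w::real\<bar>} \<in> sets borel" by measurable
    then have [measurable]: "{w::real. t \<le> \<bar>w\<bar>} \<in> sets borel" by simp
    have "(\<integral>\<^sup>+w. indicator {\<gamma>..1} t * indicator {t. t \<le> \<bar>w\<bar>} t \<partial>laplace b)
        = (\<integral>\<^sup>+w. indicator {\<gamma>..1} t * indicator {w. t \<le> \<bar>w\<bar>} w \<partial>laplace b)"
      by (intro nn_integral_cong) (auto simp: indicator_def)
    also have "\<dots> = indicator {\<gamma>..1} t * emeasure (laplace b) {w. t \<le> \<bar>w\<bar>}"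
      by (subst nn_integral_cmult) (auto intro!: borel_measurable_indicator simp: prob_space_laplace)
    also have "\<dots> = ennreal (exp (- t / b)) * indicator {\<gamma>..1} t"
      using g b by (auto simp: indicator_def emeasure_laplace_tail)
    finally show "(\<integral>\<^sup>+w. indicator {\<gamma>..1} t * indicator {t. t \<le> \<bar>w\<bar>} t \<partial>laplace b)
      = ennreal (exp (- t / b)) * indicator {\<gamma>..1} t" .
  qed
  also have "\<dots> = ennreal (- b * exp (- 1 / b) - (- b * exp (- \<gamma> / b)))"
  proof (rule nn_integral_FTC_Icc)
    fix t :: real
    show "((\<lambda>t. - b * exp (- t / b)) has_real_derivative exp (- t / b)) (at t)"
      using b by (auto intro!: derivative_eq_intros)
  qed (use g in auto)
  finally have nn: "(\<integral>\<^sup>+w. ennreal (?u w) \<partial>laplace b) = ennreal (b * (exp (- \<gamma> / b) - exp (- 1 / b)))"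
    by (simp add: algebra_simps)
  have "b * (exp (- \<gamma> / b) - exp (- 1 / b)) \<ge> 0" using b g by (simp add: divide_right_mono)
  then have I: "(\<integral>w. ?u w \<partial>laplace b) = b * (exp (- \<gamma> / b) - exp (- 1 / b))"
    by (subst integral_eq_nn_integral) (simp_all add: nn measurable_cong_sets[OF prob_space_laplace(2) refl])
  have "integrable (laplace b) (\<lambda>w. max \<gamma> (min 1 \<bar>w\<bar>))"
    by (rule integrable_const_bound[where B=1])
      (use g in \<open>auto simp: measurable_cong_sets[OF prob_space_laplace(2) refl]\<close>)
  then have "(\<integral>w. max \<gamma> (min 1 \<bar>w\<bar>) \<partial>laplace b) = \<gamma> + b * (exp (- \<gamma> / b) - exp (- 1 / b))"
    using I by (simp add: prob_space)
  then show ?thesis using False x by (simp add: noise_term_def b_def)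
qed

lemma expectation_noise_clamp:
  assumes g: "0 \<le> \<gamma>" "\<gamma> \<le> 1" and s: "0 \<le> \<sigma>" and m: "0 < m a c"
  shows "(\<integral>w. max \<gamma> (min 1 \<bar>w (a, c, k)\<bar>) \<partial>noise m \<sigma>) = \<gamma> + noise_term \<gamma> \<sigma> (real (m a c))"
    (is "integral\<^sup>L _ ?f = _")
proof -
  let ?M = "\<lambda>j. case j of (a, c, k) \<Rightarrow> laplace (\<sigma> / real (m a c))"
  have "distr (noise m \<sigma>) (?M (a, c, k)) (\<lambda>w. w (a, c, k)) = ?M (a, c, k)"
    unfolding noise_def using s by (intro distr_PiM_component) (auto intro!: prob_space_laplace)
  then have d: "distr (noise m \<sigma>) (laplace (\<sigma> / real (m a c))) (\<lambda>w. w (a, c, k)) = laplace (\<sigma> / real (m a c))"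
    by simp
  have "integral\<^sup>L (noise m \<sigma>) ?f = (\<integral>w. max \<gamma> (min 1 \<bar>w\<bar>) \<partial>laplace (\<sigma> / real (m a c)))"
    by (subst d[symmetric], subst integral_distr)
      (auto simp: noise_comp measurable_cong_sets[OF refl prob_space_laplace(2)] measurable_cong_sets[OF prob_space_laplace(2) refl])
  then show ?thesis using expectation_laplace_clamp[OF g s, of "real (m a c)"] m by simp
qed


subsection \<open>Conditioning on assignment and noise\<close>

text \<open>Expanding the square of the centered sum, independence of the coordinates makes every
  off-diagonal product have mean zero.\<close>

lemma
  fixes f :: "'i::finite \<Rightarrow> 'k::finite \<Rightarrow> real"
  shows expectation_sum_Pi_pmf: "measure_pmf.expectation (Pi_pmf UNIV d p) (\<lambda>r. \<Sum>i\<in>UNIV. f i (r i))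
      = (\<Sum>i\<in>UNIV. measure_pmf.expectation (p i) (f i))" (is ?E)
    and variance_sum_Pi_pmf: "measure_pmf.variance (Pi_pmf UNIV d p) (\<lambda>r. \<Sum>i\<in>UNIV. f i (r i))
      = (\<Sum>i\<in>UNIV. measure_pmf.variance (p i) (f i))" (is ?V)
proof -
  let ?P = "Pi_pmf UNIV d p"
  have int: "integrable (measure_pmf q) h" for q :: "'x::finite pmf" and h :: "'x \<Rightarrow> real"
    by (rule integrable_measure_pmf_finite) simp
  have comp: "measure_pmf.expectation ?P (\<lambda>r. h (r i)) = measure_pmf.expectation (p i) h" for h :: "'k \<Rightarrow> real" and i
    using integral_map_pmf[of "\<lambda>r. r i" ?P h] by (simp add: Pi_pmf_component)
  show E: ?E by (simp add: Bochner_Integration.integral_sum int comp)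
  define g where "g i k = f i k - measure_pmf.expectation (p i) (f i)" for i k
  have g0: "measure_pmf.expectation (p i) (g i) = 0" for i
    by (simp add: g_def[abs_def] int)
  have cross: "measure_pmf.expectation ?P (\<lambda>r. g i (r i) * g j (r j))
      = (if i = j then measure_pmf.variance (p i) (f i) else 0)" for i j
  proof (cases "i = j")
    case True
    then show ?thesis using comp[of "\<lambda>k. (g i k)\<^sup>2" i] by (simp add: g_def power2_eq_square)
  next
    case False
    have "prob_space.indep_vars (measure_pmf ?P) (\<lambda>_. count_space UNIV) (\<lambda>i r. r i) {i, j}"
      by (rule prob_space.indep_vars_subset[OF prob_space_measure_pmf indep_vars_Pi_pmf]) auto
    then have "prob_space.indep_vars (measure_pmf ?P) (\<lambda>_. borel) (\<lambda>i r. g i (r i)) {i, j}"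
      by (rule prob_space.indep_vars_compose2[OF prob_space_measure_pmf]) auto
    then have "measure_pmf.expectation ?P (\<lambda>r. \<Prod>i\<in>{i, j}. g i (r i)) = (\<Prod>i\<in>{i, j}. measure_pmf.expectation ?P (\<lambda>r. g i (r i)))"
      by (intro prob_space.indep_vars_lebesgue_integral[OF prob_space_measure_pmf]) (auto intro: int)
    then show ?thesis using False by (simp add: comp g0)
  qed
  have "measure_pmf.variance ?P (\<lambda>r. \<Sum>i\<in>UNIV. f i (r i))
      = measure_pmf.expectation ?P (\<lambda>r. \<Sum>i\<in>UNIV. \<Sum>j\<in>UNIV. g i (r i) * g j (r j))"
    by (simp add: E g_def sum_subtractf[symmetric] power2_eq_square sum_product)
  also have "\<dots> = (\<Sum>i\<in>UNIV. measure_pmf.variance (p i) (f i))"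
    by (simp add: Bochner_Integration.integral_sum int cross)
  finally show ?V .
qed

lemma joint_space_section_measurable:
  assumes "f \<in> borel_measurable (joint_space m \<sigma>)"
  shows "(\<lambda>w. f (z, w, r)) \<in> borel_measurable (noise m \<sigma>)"
proof -
  have "(\<lambda>w. (z, w, r)) \<in> noise m \<sigma> \<rightarrow>\<^sub>M joint_space m \<sigma>"
    unfolding joint_space_def by measurable
  then show ?thesis by (rule measurable_compose[OF _ assms])
qed

context
  fixes cl :: "'u::finite \<Rightarrow> 'c::finite" and m :: "bool \<Rightarrow> 'c \<Rightarrow> nat" and y :: "bool \<Rightarrow> 'u \<Rightarrow> 'k::finite"
    and \<gamma> \<sigma> l :: real
  assumes g: "0 \<le> \<gamma>" "\<gamma> \<le> 1 / real CARD('k)" and l: "0 \<le> l" "l < 1" and s: "0 \<le> \<sigma>"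
begin

text \<open>The release has finitely many values, so the conditional mean is a finite sum weighted
  by \<open>pmf_release\<close>, an explicit product that is measurable in the noise.\<close>

lemma expectation_release_measurable:
  fixes f :: "('u \<Rightarrow> bool) \<times> (bool \<times> 'c \<times> 'k \<Rightarrow> real) \<times> ('u \<Rightarrow> 'k) \<Rightarrow> real"
  assumes f: "f \<in> borel_measurable (joint_space m \<sigma>)"
  shows "(\<lambda>w. measure_pmf.expectation (release cl m y \<gamma> l z w) (\<lambda>r. f (z, w, r))) \<in> borel_measurable (noise m \<sigma>)"
proof -
  have "measure_pmf.expectation (release cl m y \<gamma> l z w) (\<lambda>r. f (z, w, r))
      = (\<Sum>r\<in>UNIV. f (z, w, r) * pmf (release cl m y \<gamma> l z w) r)" for w
    by (rule integral_measure_pmf_real) auto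
  then show ?thesis
    using joint_space_section_measurable[OF f] by (simp add: pmf_release[OF g l])
qed

text \<open>Tower property, obtained by integrating through the two nested binds in turn.
  Boundedness of \<open>f\<close> is what allows \<open>integral_bind\<close> to be applied to each
  of them.\<close>

lemma expectation_cluster_dp:
  fixes f :: "('u \<Rightarrow> bool) \<times> (bool \<times> 'c \<times> 'k \<Rightarrow> real) \<times> ('u \<Rightarrow> 'k) \<Rightarrow> real"
  assumes f: "f \<in> borel_measurable (joint_space m \<sigma>)" and B: "\<And>x. \<bar>f x\<bar> \<le> B"
  shows "(\<integral>x. f x \<partial>cluster_dp cl m y \<gamma> \<sigma> l) =
    measure_pmf.expectation (treatment_pmf cl m) (\<lambda>z. \<integral>w.
      measure_pmf.expectation (release cl m y \<gamma> l z w) (\<lambda>r. f (z, w, r)) \<partial>noise m \<sigma>)"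
proof -
  let ?K = "\<lambda>z w. distr (measure_pmf (release cl m y \<gamma> l z w)) (joint_space m \<sigma>) (\<lambda>r. (z, w, r))"
  let ?N = "\<lambda>z. noise m \<sigma> \<bind> ?K z"
  interpret noise: prob_space "noise m \<sigma> :: (bool \<times> 'c \<times> 'k \<Rightarrow> real) measure" by (rule prob_space_noise[OF s])
  note release_meas[OF g l, measurable]
  have pair: "(\<lambda>r. (z, w, r)) \<in> measure_pmf p \<rightarrow>\<^sub>M joint_space m \<sigma>"
    if "w \<in> space (noise m \<sigma>)" for z w and p :: "('u \<Rightarrow> 'k) pmf"
    unfolding joint_space_def using that by (simp add: space_pair_measure)
  have K: "?K z \<in> noise m \<sigma> \<rightarrow>\<^sub>M prob_algebra (joint_space m \<sigma>)" for z
    unfolding joint_space_def by measurable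
  have n: "(noise m \<sigma> :: (bool \<times> 'c \<times> 'k \<Rightarrow> real) measure) \<in> space (prob_algebra (noise m \<sigma>))"
    by (simp add: space_prob_algebra noise.prob_space_axioms)
  \<comment> \<open>The measurability rule speaks of kernels, so the law is viewed as a constant
    kernel and evaluated at an arbitrary point.\<close>
  have N: "?N z \<in> space (prob_algebra (joint_space m \<sigma>))" for z
    using measurable_space[OF measurable_bind_prob_space[OF measurable_const[OF n] K], of undefined "count_space UNIV"] by simp
  have N': "?N \<in> measure_pmf (treatment_pmf cl m) \<rightarrow>\<^sub>M subprob_algebra (joint_space m \<sigma>)"
    using N by (auto simp: space_prob_algebra space_subprob_algebra prob_space_imp_subprob_space)
  have "(\<integral>x. f x \<partial>cluster_dp cl m y \<gamma> \<sigma> l) = measure_pmf.expectation (treatment_pmf cl m) (\<lambda>z. \<integral>x. f x \<partial>?N z)"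
    unfolding cluster_dp_def
    by (rule integral_bind[OF f B N', where B'=1])
      (use N in \<open>auto simp: space_prob_algebra prob_space.emeasure_space_1 measure_pmf.finite_measure_axioms\<close>)
  also have "(\<lambda>z. \<integral>x. f x \<partial>?N z) = (\<lambda>z. \<integral>w. \<integral>x. f x \<partial>?K z w \<partial>noise m \<sigma>)"
  proof
    fix z
    have "emeasure (?K z w) (space (?K z w)) = 1" if "w \<in> space (noise m \<sigma>)" for w
      by (rule prob_space.emeasure_space_1[OF measure_pmf.prob_space_distr[OF pair[OF that]]])
    then show "(\<integral>x. f x \<partial>?N z) = (\<integral>w. \<integral>x. f x \<partial>?K z w \<partial>noise m \<sigma>)"
      by (intro integral_bind[OF f B measurable_prob_algebraD[OF K], where B'=1])
        (auto simp: noise.finite_measure_axioms)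
  qed
  also have "\<dots> = (\<lambda>z. \<integral>w. measure_pmf.expectation (release cl m y \<gamma> l z w) (\<lambda>r. f (z, w, r)) \<partial>noise m \<sigma>)"
    by (intro ext Bochner_Integration.integral_cong refl integral_distr pair f)
  finally show ?thesis .
qed

text \<open>Law of total variance. The conditional mean \<open>t z\<close> given assignment and
  noise depends on the assignment alone, so its variance is taken under the treatment law.\<close>

lemma variance_cluster_dp:
  fixes X :: "('u \<Rightarrow> bool) \<times> (bool \<times> 'c \<times> 'k \<Rightarrow> real) \<times> ('u \<Rightarrow> 'k) \<Rightarrow> real"
  assumes X: "X \<in> borel_measurable (joint_space m \<sigma>)" and B: "\<And>x. \<bar>X x\<bar> \<le> B"
    and mean: "\<And>z w. measure_pmf.expectation (release cl m y \<gamma> l z w) (\<lambda>r. X (z, w, r)) = t z"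
  shows "prob_space.variance (cluster_dp cl m y \<gamma> \<sigma> l) X = measure_pmf.variance (treatment_pmf cl m) t
    + measure_pmf.expectation (treatment_pmf cl m) (\<lambda>z. \<integral>w.
        measure_pmf.variance (release cl m y \<gamma> l z w) (\<lambda>r. X (z, w, r)) \<partial>noise m \<sigma>)"
proof -
  interpret noise: prob_space "noise m \<sigma> :: (bool \<times> 'c \<times> 'k \<Rightarrow> real) measure" by (rule prob_space_noise[OF s])
  define \<mu> where "\<mu> = (\<integral>x. X x \<partial>cluster_dp cl m y \<gamma> \<sigma> l)"
  have int: "integrable (measure_pmf q) h" for q :: "'x::finite pmf" and h :: "'x \<Rightarrow> real"
    by (rule integrable_measure_pmf_finite) simp
  have \<mu>: "\<mu> = measure_pmf.expectation (treatment_pmf cl m) t"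
    unfolding \<mu>_def by (subst expectation_cluster_dp[OF X B]) (simp add: mean noise.prob_space)
  define V where "V z w = measure_pmf.variance (release cl m y \<gamma> l z w) (\<lambda>r. X (z, w, r))" for z w
  have Veq: "V z w = measure_pmf.expectation (release cl m y \<gamma> l z w) (\<lambda>r. (X (z, w, r))\<^sup>2) - (t z)\<^sup>2" for z w
    unfolding V_def by (subst measure_pmf.variance_eq) (auto intro: int simp: mean)
  have dec: "measure_pmf.expectation (release cl m y \<gamma> l z w) (\<lambda>r. (X (z, w, r) - \<mu>)\<^sup>2) = V z w + (t z - \<mu>)\<^sup>2" for z w
    by (simp add: Veq power2_diff int mean)
  have B2: "(X x)\<^sup>2 \<le> B\<^sup>2" for x using B[of x] by (simp add: abs_le_square_iff[symmetric])
  have intV: "integrable (noise m \<sigma>) (V z)" for z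
  proof -
    have "integrable (noise m \<sigma>) (\<lambda>w. measure_pmf.expectation (release cl m y \<gamma> l z w) (\<lambda>r. (X (z, w, r))\<^sup>2))"
    proof (rule noise.integrable_const_bound[where B="B\<^sup>2"])
      have "0 \<le> measure_pmf.expectation (release cl m y \<gamma> l z w) (\<lambda>r. (X (z, w, r))\<^sup>2)"
        "measure_pmf.expectation (release cl m y \<gamma> l z w) (\<lambda>r. (X (z, w, r))\<^sup>2) \<le> B\<^sup>2" for w
        by (auto intro!: measure_pmf.integral_le_const int B2 integral_nonneg)
      then show "AE w in noise m \<sigma>. norm (measure_pmf.expectation (release cl m y \<gamma> l z w) (\<lambda>r. (X (z, w, r))\<^sup>2)) \<le> B\<^sup>2"
        by simp
      show "(\<lambda>w. measure_pmf.expectation (release cl m y \<gamma> l z w) (\<lambda>r. (X (z, w, r))\<^sup>2)) \<in> borel_measurable (noise m \<sigma>)"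
        by (rule expectation_release_measurable[of "\<lambda>x. (X x)\<^sup>2"]) (use X in measurable)
    qed
    then show ?thesis by (simp add: Veq[abs_def])
  qed
  have "prob_space.variance (cluster_dp cl m y \<gamma> \<sigma> l) X = (\<integral>x. (X x - \<mu>)\<^sup>2 \<partial>cluster_dp cl m y \<gamma> \<sigma> l)"
    by (simp add: \<mu>_def)
  also have "\<dots> = measure_pmf.expectation (treatment_pmf cl m) (\<lambda>z. \<integral>w. V z w + (t z - \<mu>)\<^sup>2 \<partial>noise m \<sigma>)"
  proof (subst expectation_cluster_dp)
    show "(\<lambda>x. (X x - \<mu>)\<^sup>2) \<in> borel_measurable (joint_space m \<sigma>)" using X by measurable
    show "\<bar>(X x - \<mu>)\<^sup>2\<bar> \<le> (B + \<bar>\<mu>\<bar>)\<^sup>2" for x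
      using B[of x] by (simp add: abs_le_square_iff[symmetric])
  qed (simp add: dec)
  also have "\<dots> = measure_pmf.expectation (treatment_pmf cl m) (\<lambda>z. (\<integral>w. V z w \<partial>noise m \<sigma>) + (t z - \<mu>)\<^sup>2)"
    using intV by (simp add: noise.prob_space)
  also have "\<dots> = measure_pmf.expectation (treatment_pmf cl m) (\<lambda>z. \<integral>w. V z w \<partial>noise m \<sigma>)
      + measure_pmf.variance (treatment_pmf cl m) t"
    by (simp add: int \<mu>)
  finally show ?thesis by (simp add: V_def)
qed

end


subsection \<open>The excess variance of the estimator\<close>

lemma variance_pmf_affine:
  fixes p :: "'k::finite pmf" and f :: "'k \<Rightarrow> real" and a b d :: real
  shows "measure_pmf.variance p (\<lambda>k. a * ((f k - b) / d)) = a\<^sup>2 / d\<^sup>2 * measure_pmf.variance p f"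
proof -
  have int: "integrable (measure_pmf p) h" for h :: "'k \<Rightarrow> real"
    by (rule integrable_measure_pmf_finite) simp
  have f: "a * ((f k - b) / d) = a / d * f k - a * b / d" for k
    by (simp only: diff_divide_distrib right_diff_distrib times_divide_eq_left times_divide_eq_right)
  have "measure_pmf.expectation p (\<lambda>k. a / d * f k - a * b / d) = a / d * measure_pmf.expectation p f - a * b / d"
    by (simp add: int)
  then have "a / d * f k - a * b / d - measure_pmf.expectation p (\<lambda>k. a / d * f k - a * b / d)
      = a / d * (f k - measure_pmf.expectation p f)" for k
    by (simp only: right_diff_distrib)
  then show ?thesis unfolding f
    by (simp only: power_mult_distrib power_divide integral_mult_right_zero)
qed

text \<open>The sign encodes the difference of the two arms, so that both estimators become single
  sums over units with the same weights.\<close>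

definition unit_weight ::
  "('u::finite \<Rightarrow> 'c) \<Rightarrow> (bool \<Rightarrow> 'c \<Rightarrow> nat) \<Rightarrow> ('u \<Rightarrow> bool) \<Rightarrow> 'u \<Rightarrow> real" where
  "unit_weight cl m z i =
     real (card (cluster cl (cl i))) / real CARD('u) * ((if z i then 1 else -1) / real (m (z i) (cl i)))"

lemma unit_weight_sq:
  "(unit_weight cl m z i)\<^sup>2 =
    (real (card (cluster cl (cl i))))\<^sup>2 / (real CARD('u))\<^sup>2 / (real (m (z i) (cl i)))\<^sup>2"
  for cl :: "'u::finite \<Rightarrow> 'c"
  by (simp add: unit_weight_def power_mult_distrib power_divide)

lemma sum_clusters:
  fixes cl :: "'u::finite \<Rightarrow> 'c::finite"
  shows "(\<Sum>c\<in>UNIV. \<Sum>i\<in>cluster cl c. f c i) = (\<Sum>i\<in>UNIV. f (cl i) i)"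
proof -
  have "(\<Sum>c\<in>UNIV. \<Sum>i\<in>cluster cl c. f c i) = (\<Sum>c\<in>UNIV. \<Sum>i | i \<in> UNIV \<and> cl i = c. f (cl i) i)"
    by (intro sum.cong) (auto simp: cluster_def)
  also have "\<dots> = (\<Sum>i\<in>UNIV. f (cl i) i)" by (rule sum.group) auto
  finally show ?thesis .
qed

lemma sum_arms:
  fixes cl :: "'u::finite \<Rightarrow> 'c::finite"
  shows "(\<Sum>i\<in>UNIV. f (z i) (cl i) i) = (\<Sum>a\<in>UNIV. \<Sum>c\<in>UNIV. \<Sum>i\<in>arm cl z a c. f a c i)"
proof -
  have "(\<Sum>i\<in>UNIV. f (z i) (cl i) i) = (\<Sum>p\<in>UNIV. \<Sum>i | i \<in> UNIV \<and> (z i, cl i) = p. f (z i) (cl i) i)"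
    by (rule sum.group[symmetric]) auto
  also have "\<dots> = (\<Sum>p\<in>UNIV \<times> UNIV. case p of (a, c) \<Rightarrow> \<Sum>i\<in>arm cl z a c. f a c i)"
    by (rule sum.cong) (auto simp: arm_def intro!: sum.cong)
  also have "\<dots> = (\<Sum>a\<in>UNIV. \<Sum>c\<in>UNIV. \<Sum>i\<in>arm cl z a c. f a c i)"
    by (rule sum.cartesian_product[symmetric])
  finally show ?thesis .
qed

lemma tau_Q_eq:
  fixes cl :: "'u::finite \<Rightarrow> 'c::finite"
  shows "tau_Q cl m val y \<gamma> l (z, w, r) =
    (\<Sum>i\<in>UNIV. unit_weight cl m z i * debiased val l (private_freq cl m y \<gamma> z w (z i) (cl i)) (r i))"
  unfolding tau_Q_def unit_weight_def
  by (simp add: sum_distrib_left sum_clusters) (auto intro!: sum.cong)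

lemma tau_no_dp_eq:
  fixes cl :: "'u::finite \<Rightarrow> 'c::finite"
  shows "tau_no_dp cl m val y z = (\<Sum>i\<in>UNIV. unit_weight cl m z i * val (observed y z i))"
  unfolding tau_no_dp_def unit_weight_def
  by (simp add: sum_distrib_left sum_clusters) (auto intro!: sum.cong)

section \<open>Measurability, range and conditional moments of the estimator\<close>

context
  fixes cl :: "'u::finite \<Rightarrow> 'c::finite" and m :: "bool \<Rightarrow> 'c \<Rightarrow> nat" and val :: "'k::finite \<Rightarrow> real"
    and y :: "bool \<Rightarrow> 'u \<Rightarrow> 'k" and \<gamma> l :: real
  assumes g: "0 \<le> \<gamma>" "\<gamma> \<le> 1 / real CARD('k)" and l: "0 \<le> l" "l < 1"
begin

lemma debiased_private_freq:
  "debiased val l (private_freq cl m y \<gamma> z w a c) k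
    = (val k - l * (\<Sum>k\<in>UNIV. val k * private_freq cl m y \<gamma> z w a c k)) / (1 - l)"
  using l by (intro debiased_eq private_freq(2)[OF g]) auto

lemma tau_Q_measurable: "tau_Q cl m val y \<gamma> l \<in> borel_measurable (joint_space m \<sigma>)"
proof -
  have "(\<lambda>(w, r). tau_Q cl m val y \<gamma> l (z, w, r)) \<in> borel_measurable (noise m \<sigma> \<Otimes>\<^sub>M count_space UNIV)" for z
  proof -
    have [measurable]: "(\<lambda>x. private_freq cl m y \<gamma> z (fst x) a c k) \<in> borel_measurable (noise m \<sigma> \<Otimes>\<^sub>M count_space UNIV)" for a c k
      by (rule measurable_compose[OF measurable_fst private_meas])
    have [measurable]: "(\<lambda>x. val (snd x i)) \<in> borel_measurable (noise m \<sigma> \<Otimes>\<^sub>M count_space UNIV)" for i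
      by (rule measurable_compose[OF measurable_snd, of "\<lambda>r. val (r i)"]) simp
    show ?thesis unfolding tau_Q_eq debiased_private_freq case_prod_beta' by measurable
  qed
  \<comment> \<open>There are only finitely many assignments, so joint measurability reduces to
    measurability for each fixed \<open>z\<close>.\<close>
  then have "tau_Q cl m val y \<gamma> l \<in> borel_measurable (count_space UNIV \<Otimes>\<^sub>M (noise m \<sigma> \<Otimes>\<^sub>M count_space UNIV))"
    by (intro measurable_pair_measure_countable1) (auto simp: case_prod_beta')
  then show ?thesis by (simp add: joint_space_def)
qed

text \<open>Only the existence of a bound matters for the integrability conditions, hence the crude
  constants: \<open>M\<close> dominates every outcome and every mean of outcomes, and
  \<open>W\<close> sums over all assignments to be uniform in \<open>z\<close>.\<close>

lemma tau_Q_bounded: "\<exists>B. \<forall>x. \<bar>tau_Q cl m val y \<gamma> l x\<bar> \<le> B"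
proof -
  define M where "M = (\<Sum>k\<in>UNIV. \<bar>val k\<bar>)"
  define W where "W = (\<Sum>z\<in>UNIV. \<Sum>i\<in>UNIV. \<bar>unit_weight cl m z i\<bar>)"
  have vM: "\<bar>val k\<bar> \<le> M" for k unfolding M_def by (rule member_le_sum) auto
  have D: "\<bar>debiased val l (private_freq cl m y \<gamma> z w a c) k\<bar> \<le> (M + M) / (1 - l)" for z w a c k
  proof -
    let ?q = "private_freq cl m y \<gamma> z w a c"
    have "\<bar>\<Sum>k\<in>UNIV. val k * ?q k\<bar> \<le> (\<Sum>k\<in>UNIV. M * ?q k)"
      by (rule order_trans[OF sum_abs])
        (auto simp: abs_mult private_freq[OF g] intro!: sum_mono mult_right_mono vM)
    then have "\<bar>\<Sum>k\<in>UNIV. val k * ?q k\<bar> \<le> M" by (simp add: sum_distrib_left[symmetric] private_freq[OF g])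
    then have "l * \<bar>\<Sum>k\<in>UNIV. val k * ?q k\<bar> \<le> 1 * M" using l by (intro mult_mono) auto
    moreover have "\<bar>val k - l * (\<Sum>k\<in>UNIV. val k * ?q k)\<bar> \<le> \<bar>val k\<bar> + l * \<bar>\<Sum>k\<in>UNIV. val k * ?q k\<bar>"
      using l by (intro order_trans[OF abs_triangle_ineq4]) (simp add: abs_mult)
    ultimately have "\<bar>val k - l * (\<Sum>k\<in>UNIV. val k * ?q k)\<bar> \<le> M + M"
      using vM[of k] by linarith
    then show ?thesis using l by (simp add: debiased_private_freq divide_right_mono)
  qed
  have "\<bar>tau_Q cl m val y \<gamma> l x\<bar> \<le> W * ((M + M) / (1 - l))" for x
  proof -
    obtain z w r where x: "x = (z, w, r)" by (cases x)
    have M0: "0 \<le> M" by (simp add: M_def sum_nonneg)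
    have "\<bar>tau_Q cl m val y \<gamma> l x\<bar> \<le> (\<Sum>i\<in>UNIV. \<bar>unit_weight cl m z i\<bar> * ((M + M) / (1 - l)))"
      unfolding x tau_Q_eq by (rule order_trans[OF sum_abs]) (auto simp only: abs_mult intro!: sum_mono mult_left_mono D abs_ge_zero)
    also have "\<dots> = (\<Sum>i\<in>UNIV. \<bar>unit_weight cl m z i\<bar>) * ((M + M) / (1 - l))"
      by (simp only: sum_distrib_right)
    also have "\<dots> \<le> W * ((M + M) / (1 - l))"
      unfolding W_def using M0 l
      by (intro mult_right_mono member_le_sum[of z UNIV "\<lambda>z. \<Sum>i\<in>UNIV. \<bar>unit_weight cl m z i\<bar>"])
        (auto simp: sum_nonneg)
    finally show ?thesis .
  qed
  then show ?thesis by blast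
qed

text \<open>With \<open>\<mu>\<close> the mean of the private frequencies, the mixture gives
  \<open>val k - l * \<mu>\<close> the mean
  \<open>l * (1 - l) * \<mu> + (1 - l) * (val k0 - l * \<mu>)\<close>. The terms in
  \<open>\<mu>\<close> cancel, whatever the noise is.\<close>

lemma expectation_tau_Q_release:
  "measure_pmf.expectation (release cl m y \<gamma> l z w) (\<lambda>r. tau_Q cl m val y \<gamma> l (z, w, r)) = tau_no_dp cl m val y z"
proof -
  have "measure_pmf.expectation (release_unit l (private_freq cl m y \<gamma> z w a c) k0)
      (debiased val l (private_freq cl m y \<gamma> z w a c)) = val k0" for a c k0
  proof -
    let ?q = "private_freq cl m y \<gamma> z w a c"
    define \<mu> where "\<mu> = (\<Sum>k\<in>UNIV. val k * ?q k)"
    have "(\<Sum>k\<in>UNIV. (val k - l * \<mu>) * ?q k) = (1 - l) * \<mu>"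
      by (simp only: left_diff_distrib sum_subtractf sum_distrib_left[symmetric] private_freq(2)[OF g] \<mu>_def mult_1_right mult_1_left)
    then have "measure_pmf.expectation (release_unit l ?q k0) (\<lambda>k. val k - l * \<mu>) = (1 - l) * val k0"
      using l by (simp only: expectation_release_unit[OF private_freq[OF g]] less_imp_le) (simp add: algebra_simps)
    then show ?thesis
      using l by (simp add: debiased_private_freq[abs_def] \<mu>_def[symmetric])
  qed
  then show ?thesis
    unfolding tau_Q_eq tau_no_dp_eq release_def
    by (subst expectation_sum_Pi_pmf[where f = "\<lambda>i k. unit_weight cl m z i *
          debiased val l (private_freq cl m y \<gamma> z w (z i) (cl i)) k"]) simp
qed

text \<open>Given assignment and noise, the releases are independent and the shift in the affine
  correction is constant; only the scale \<open>1 / (1 - l)\<close> and the squared weights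
  survive.\<close>

lemma variance_tau_Q_release:
  "measure_pmf.variance (release cl m y \<gamma> l z w) (\<lambda>r. tau_Q cl m val y \<gamma> l (z, w, r))
   = (\<Sum>a\<in>UNIV. \<Sum>c\<in>UNIV. (real (card (cluster cl c)))\<^sup>2 / (real CARD('u))\<^sup>2 / (real (m a c))\<^sup>2 / (1 - l)\<^sup>2 *
      (\<Sum>i\<in>arm cl z a c. measure_pmf.variance (release_unit l (private_freq cl m y \<gamma> z w a c) (y a i)) val))"
proof -
  have "measure_pmf.variance (release cl m y \<gamma> l z w) (\<lambda>r. tau_Q cl m val y \<gamma> l (z, w, r))
    = (\<Sum>i\<in>UNIV. (real (card (cluster cl (cl i))))\<^sup>2 / (real CARD('u))\<^sup>2 / (real (m (z i) (cl i)))\<^sup>2 / (1 - l)\<^sup>2 *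
        measure_pmf.variance (release_unit l (private_freq cl m y \<gamma> z w (z i) (cl i)) (y (z i) i)) val)"
    unfolding tau_Q_eq release_def
    by (subst variance_sum_Pi_pmf[where f = "\<lambda>i k. unit_weight cl m z i *
          debiased val l (private_freq cl m y \<gamma> z w (z i) (cl i)) k"])
      (simp only: debiased_private_freq variance_pmf_affine observed_def unit_weight_sq)
  also have "\<dots> = (\<Sum>a\<in>UNIV. \<Sum>c\<in>UNIV. \<Sum>i\<in>arm cl z a c. (real (card (cluster cl c)))\<^sup>2 / (real CARD('u))\<^sup>2 / (real (m a c))\<^sup>2 / (1 - l)\<^sup>2 *
        measure_pmf.variance (release_unit l (private_freq cl m y \<gamma> z w a c) (y a i)) val)"
    by (rule sum_arms)
  finally show ?thesis by (simp only: sum_distrib_left)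
qed

text \<open>The factor 6 is the 3 from exchanging distributions times the 2 from renormalization;
  the clamping error is bounded label by label.\<close>

lemma sum_variance_release_arm_le:
  assumes n: "card (arm cl z a c) = m a c" "1 \<le> m a c" and M: "\<And>k. \<bar>val k\<bar> \<le> M"
  shows "(\<Sum>i\<in>arm cl z a c. measure_pmf.variance (release_unit l (private_freq cl m y \<gamma> z w a c) (y a i)) val)
    \<le> l * (2 - l) * sum_sq_dev (arm cl z a c) (\<lambda>i. val (y a i))
      + 6 * l * M\<^sup>2 * real (m a c) * (\<Sum>k\<in>UNIV. max \<gamma> (min 1 \<bar>w (a, c, k)\<bar>))"
proof -
  let ?S = "arm cl z a c" and ?p = "emp_freq cl m y z a c" and ?q = "noisy_freq cl m y \<gamma> z w a c"
  have ne: "?S \<noteq> {}" using n by auto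
  have "1 / real CARD('k) \<le> 1" by (simp add: divide_le_eq Suc_le_eq)
  then have g1: "\<gamma> \<le> 1" using g by linarith
  have p: "?p k = real (card {i \<in> ?S. y a i = k}) / real (card ?S)" for k
    unfolding emp_freq_def n(1) by (intro arg_cong2[where f="(/)"] arg_cong[where f=real] arg_cong[where f=card] refl)
      (auto simp: arm_def observed_def)
  have p1: "(\<Sum>k\<in>UNIV. ?p k) = 1"
  proof -
    have "(\<Sum>k\<in>UNIV. ?p k) * real (card ?S) = real (card ?S)"
      using sum_labels[of ?S "\<lambda>_. 1" "y a"] ne by (simp add: p sum_divide_distrib[symmetric])
    then show ?thesis using n by simp
  qed
  have p0: "0 \<le> ?p k" for k by (simp add: p)
  have ple: "?p k \<le> 1" for k
    using member_le_sum[of k UNIV ?p] p0 p1 by simp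
  have q: "\<gamma> \<le> ?q k" "?q k \<le> 1" for k using g1 by (auto simp: noisy_freq_def)
  have "(\<Sum>k\<in>UNIV. \<bar>private_freq cl m y \<gamma> z w a c k - ?p k\<bar>) \<le> 2 * (\<Sum>k\<in>UNIV. \<bar>?q k - ?p k\<bar>)"
    unfolding private_freq_def by (rule sum_abs_renormalize_le[OF q p1])
  also have "\<dots> \<le> 2 * (\<Sum>k\<in>UNIV. max \<gamma> (min 1 \<bar>w (a, c, k)\<bar>))"
    unfolding noisy_freq_def by (intro mult_left_mono sum_mono abs_clamp_diff_le p0 ple g g1) auto
  finally have d: "(\<Sum>k\<in>UNIV. \<bar>private_freq cl m y \<gamma> z w a c k - ?p k\<bar>) \<le> 2 * (\<Sum>k\<in>UNIV. max \<gamma> (min 1 \<bar>w (a, c, k)\<bar>))" .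
  have "(\<Sum>i\<in>?S. measure_pmf.variance (release_unit l (private_freq cl m y \<gamma> z w a c) (y a i)) val)
    \<le> l * (2 - l) * sum_sq_dev ?S (\<lambda>i. val (y a i))
      + 3 * l * M\<^sup>2 * real (m a c) * (\<Sum>k\<in>UNIV. \<bar>private_freq cl m y \<gamma> z w a c k - ?p k\<bar>)"
    unfolding p using l ne M
    by (subst n(1)[symmetric], intro sum_variance_release_unit_le private_freq[OF g]) auto
  also have "\<dots> \<le> l * (2 - l) * sum_sq_dev ?S (\<lambda>i. val (y a i))
      + 3 * l * M\<^sup>2 * real (m a c) * (2 * (\<Sum>k\<in>UNIV. max \<gamma> (min 1 \<bar>w (a, c, k)\<bar>)))"
    using l d by (intro add_left_mono mult_left_mono) auto
  finally show ?thesis by simp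
qed

end

lemma noise_term_nonneg:
  assumes "\<gamma> \<le> 1" "0 \<le> \<sigma>" "0 < x"
  shows "0 \<le> noise_term \<gamma> \<sigma> x"
proof -
  have "\<gamma> * x \<le> x" using assms by simp
  then have "exp (- x / \<sigma>) \<le> exp (- \<gamma> * x / \<sigma>)" using assms by (simp add: divide_right_mono)
  then show ?thesis using assms unfolding noise_term_def by simp
qed

text \<open>Since \<open>l \<le> 1\<close>, the left side is dominated by the summand of
  \<open>A_fun\<close> with coefficient 3. The other summands are nonnegative, because
  \<open>l * (K - 1) * \<gamma>\<close> is at most \<open>K * \<gamma> \<le> 1\<close>.\<close>

lemma A_fun_ge:
  fixes val :: "'k::finite \<Rightarrow> real"
  assumes g: "0 \<le> \<gamma>" "\<gamma> \<le> 1 / real CARD('k)" and l: "0 \<le> l" "l < 1" and s: "0 \<le> \<sigma>" and x: "0 < x"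
  shows "6 * l * (infnorm (outcome_vec val))\<^sup>2 * (real CARD('k) * (\<gamma> + noise_term \<gamma> \<sigma> x)) / (1 - l)\<^sup>2
    \<le> A_fun val \<gamma> \<sigma> l x"
proof -
  let ?K = "real CARD('k)" and ?M = "infnorm (outcome_vec val)"
  define N where "N = \<gamma> + noise_term \<gamma> \<sigma> x"
  have K: "1 \<le> ?K" by (simp add: Suc_le_eq)
  then have "?K * \<gamma> \<le> 1" using g by (simp add: field_simps)
  then have g1: "\<gamma> \<le> 1" using mult_right_mono[OF K g(1)] by simp
  have "l * ((?K - 1) * \<gamma>) \<le> 1 * 1"
    using l K g \<open>?K * \<gamma> \<le> 1\<close> by (intro mult_mono mult_nonneg_nonneg) (auto simp: left_diff_distrib)
  then have nn: "0 \<le> (l * sqrt ?K + 1)\<^sup>2 * (norm (outcome_vec val))\<^sup>2 * (1 - l * (?K - 1) * \<gamma>)"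
    by (simp add: mult.assoc)
  have "l * (3 * ?M\<^sup>2) \<le> 1 * (3 * ?M\<^sup>2)" using l by (intro mult_right_mono) auto
  then have "3 * l * ?M\<^sup>2 / (1 - l)\<^sup>2
      \<le> (3 * ?M\<^sup>2 + (l * sqrt ?K + 1)\<^sup>2 * (norm (outcome_vec val))\<^sup>2 * (1 - l * (?K - 1) * \<gamma>)) / (1 - l)\<^sup>2"
    using nn by (intro divide_right_mono) auto
  then have "3 * l * ?M\<^sup>2 / (1 - l)\<^sup>2
      \<le> 2 * ?M\<^sup>2 + (3 * ?M\<^sup>2 + (l * sqrt ?K + 1)\<^sup>2 * (norm (outcome_vec val))\<^sup>2 * (1 - l * (?K - 1) * \<gamma>)) / (1 - l)\<^sup>2"
    using zero_le_power2[of ?M] by linarith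
  then have "2 * ?K * N * (3 * l * ?M\<^sup>2 / (1 - l)\<^sup>2) \<le> A_fun val \<gamma> \<sigma> l x"
    unfolding A_fun_def N_def using g noise_term_nonneg[OF g1 s x] by (intro mult_left_mono) auto
  then show ?thesis unfolding N_def[symmetric] by (simp add: mult_ac)
qed

theorem theorem3p5:
  fixes cl :: "'u::finite \<Rightarrow> 'c::finite"
    and m :: "bool \<Rightarrow> 'c \<Rightarrow> nat"
    and val :: "'k::finite \<Rightarrow> real"
    and y :: "bool \<Rightarrow> 'u \<Rightarrow> 'k"
    and \<gamma> \<sigma> l :: real
  assumes "inj val"
    and "\<And>c. card (cluster cl c) \<ge> 2"
    and "\<And>a c. m a c \<ge> 1"
    and "\<And>c. m True c + m False c = card (cluster cl c)"
    and "0 \<le> \<gamma>" and "\<gamma> \<le> 1 / real CARD('k)"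
    and "0 \<le> \<sigma>"
    and "0 \<le> l" and "l < 1"
  defines "\<Delta> \<equiv>
      prob_space.variance (cluster_dp cl m y \<gamma> \<sigma> l) (tau_Q cl m val y \<gamma> l)
    - measure_pmf.variance (treatment_pmf cl m) (tau_no_dp cl m val y)"
  shows "0 \<le> \<Delta> \<and>
    \<Delta> \<le> (1 / (1 - l)\<^sup>2 - 1) * (\<Sum>a\<in>UNIV. phi cl m val y a)
      + (\<Sum>a\<in>UNIV. \<Sum>c\<in>UNIV.
           (real (card (cluster cl c)))\<^sup>2 / (real CARD('u))\<^sup>2 *
           (A_fun val \<gamma> \<sigma> l (real (m a c)) / real (m a c)))"
proof -
  note c2 = assms(2) and m1 = assms(3) and msum = assms(4) and g = assms(5,6) and s = assms(7) and l = assms(8,9)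
  interpret noise: prob_space "noise m \<sigma> :: (bool \<times> 'c \<times> 'k \<Rightarrow> real) measure" by (rule prob_space_noise[OF s])
  let ?T = "treatment_pmf cl m" and ?N = "noise m \<sigma> :: (bool \<times> 'c \<times> 'k \<Rightarrow> real) measure"
  have intT: "integrable (measure_pmf ?T) h" for h :: "_ \<Rightarrow> real"
    by (rule integrable_measure_pmf_finite) simp
  define M where "M = infnorm (outcome_vec val)"
  define K where "K = real CARD('k)"
  have M: "\<bar>val k\<bar> \<le> M" for k
    using component_le_infnorm_cart[of "outcome_vec val" k] by (simp add: M_def outcome_vec_def)
  have "1 / real CARD('k) \<le> 1" by (simp add: divide_le_eq Suc_le_eq)
  then have g1: "\<gamma> \<le> 1" using g by linarith
  have mpos: "0 < real (m a c)" for a c using m1[of a c] by linarith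
  define \<omega> where "\<omega> c = (real (card (cluster cl c)))\<^sup>2 / (real CARD('u))\<^sup>2" for c
  have \<omega>: "0 \<le> \<omega> c" for c by (simp add: \<omega>_def)
  define V where "V z w = measure_pmf.variance (release cl m y \<gamma> l z w) (\<lambda>r. tau_Q cl m val y \<gamma> l (z, w, r))" for z w
  obtain B where B: "\<And>x. \<bar>tau_Q cl m val y \<gamma> l x\<bar> \<le> B"
    using tau_Q_bounded[OF g l, of cl m val y] by blast
  \<comment> \<open>Total variance with conditional mean \<open>tau_no_dp\<close>: the excess is the
    mean conditional variance, and the lower bound follows from its sign.\<close>
  have \<Delta>: "\<Delta> = measure_pmf.expectation ?T (\<lambda>z. \<integral>w. V z w \<partial>?N)"
    unfolding \<Delta>_def V_def
    by (subst variance_cluster_dp[OF g l s tau_Q_measurable[OF g l] B expectation_tau_Q_release[OF g l]]) simp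
  have V0: "0 \<le> V z w" for z w unfolding V_def by simp
  define u where "u w a c = (\<Sum>k\<in>UNIV. max \<gamma> (min 1 \<bar>w (a, c, k)\<bar>))" for w :: "bool \<times> 'c \<times> 'k \<Rightarrow> real" and a c
  define R where "R z w = (\<Sum>a\<in>UNIV. \<Sum>c\<in>UNIV. \<omega> c / (real (m a c))\<^sup>2 / (1 - l)\<^sup>2 *
      (l * (2 - l) * sum_sq_dev (arm cl z a c) (\<lambda>i. val (y a i)) + 6 * l * M\<^sup>2 * real (m a c) * u w a c))" for z w
  \<comment> \<open>The arms are known to have the prescribed sizes for assignments in the support,
    so the bound is stated for those.\<close>
  have VR: "V z w \<le> R z w" if z: "z \<in> set_pmf ?T" for z w
    unfolding V_def R_def u_def variance_tau_Q_release[OF g l] \<omega>_def[symmetric]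
    by (intro sum_mono mult_left_mono sum_variance_release_arm_le[OF g l] card_arm[where m=m, OF msum z] m1 M)
      (simp add: \<omega>)
  have intu: "integrable ?N (\<lambda>w. max \<gamma> (min 1 \<bar>w j\<bar>))" for j
    by (rule noise.integrable_const_bound[where B=1]) (use g g1 in auto)
  have Eu: "(\<integral>w. u w a c \<partial>?N) = K * (\<gamma> + noise_term \<gamma> \<sigma> (real (m a c)))" for a c
    unfolding u_def using mpos[of a c]
    by (subst Bochner_Integration.integral_sum)
      (auto simp: intu K_def expectation_noise_clamp[OF g(1) g1 s])
  have intu': "integrable ?N (\<lambda>w. u w a c)" for a c
    unfolding u_def by (auto simp: intu)
  have intR: "integrable ?N (R z)" for z
    unfolding R_def by (auto simp: intu')
  \<comment> \<open>\<open>R\<close> with the noise integrated out: each clamped term is replaced by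
    its mean, the same for all labels, and the assignment remains only in the sums of squared
    deviations.\<close>
  define R' where "R' z = (\<Sum>a\<in>UNIV. \<Sum>c\<in>UNIV. \<omega> c / (real (m a c))\<^sup>2 / (1 - l)\<^sup>2 *
      (l * (2 - l) * sum_sq_dev (arm cl z a c) (\<lambda>i. val (y a i))
        + 6 * l * M\<^sup>2 * real (m a c) * (K * (\<gamma> + noise_term \<gamma> \<sigma> (real (m a c))))))" for z
  have ER: "(\<integral>w. R z w \<partial>?N) = R' z" for z
    unfolding R_def R'_def by (simp add: Bochner_Integration.integral_sum intu' Eu noise.prob_space)
  \<comment> \<open>Monotonicity is used in the form asking for an integrable nonnegative majorant;
    \<open>R z\<close> is nonnegative because it dominates a variance.\<close>
  have "(\<integral>w. V z w \<partial>?N) \<le> R' z" if z: "z \<in> set_pmf ?T" for z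
    unfolding ER[symmetric] by (intro integral_mono_AE' AE_I2 intR VR z order_trans[OF V0 VR])
  then have "\<Delta> \<le> measure_pmf.expectation ?T R'"
    unfolding \<Delta> by (intro integral_mono_AE AE_pmfI intT)
  also have "\<dots> = (\<Sum>a\<in>UNIV. \<Sum>c\<in>UNIV. \<omega> c / (real (m a c))\<^sup>2 / (1 - l)\<^sup>2 *
      (l * (2 - l) * ((real (m a c) - 1) * sample_var (cluster cl c) (\<lambda>i. val (y a i)))
        + 6 * l * M\<^sup>2 * real (m a c) * (K * (\<gamma> + noise_term \<gamma> \<sigma> (real (m a c))))))"
    unfolding R'_def using expectation_sum_sq_dev_arm[where m=m, OF msum m1 c2]
    by (simp add: Bochner_Integration.integral_sum intT)
  also have "\<dots> \<le> (\<Sum>a\<in>UNIV. \<Sum>c\<in>UNIV. (1 / (1 - l)\<^sup>2 - 1) * (\<omega> c * (sample_var (cluster cl c) (\<lambda>i. val (y a i)) / real (m a c)))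
      + \<omega> c * (A_fun val \<gamma> \<sigma> l (real (m a c)) / real (m a c)))"
  proof (intro sum_mono)
    fix a c
    let ?n = "real (m a c)" and ?S = "sample_var (cluster cl c) (\<lambda>i. val (y a i))"
    define E where "E = 6 * l * M\<^sup>2 * (K * (\<gamma> + noise_term \<gamma> \<sigma> ?n)) / (1 - l)\<^sup>2"
    define \<kappa> where "\<kappa> = l * (2 - l) / (1 - l)\<^sup>2"
    have \<kappa>: "\<kappa> = 1 / (1 - l)\<^sup>2 - 1"
    proof -
      have "l * (2 - l) = 1 - (1 - l)\<^sup>2" by (simp add: power2_eq_square algebra_simps)
      then show ?thesis using l by (simp add: \<kappa>_def diff_divide_distrib)
    qed
    have \<kappa>0: "0 \<le> \<kappa>" using l by (simp add: \<kappa>_def)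
    have "0 \<le> real (card (cluster cl c)) - 1" using c2[of c] by simp
    then have S: "0 \<le> ?S" by (simp add: sample_var_def sum_nonneg)
    have "\<omega> c / ?n\<^sup>2 / (1 - l)\<^sup>2 * (l * (2 - l) * ((?n - 1) * ?S) + 6 * l * M\<^sup>2 * ?n * (K * (\<gamma> + noise_term \<gamma> \<sigma> ?n)))
        = \<omega> c / ?n\<^sup>2 * (\<kappa> * ((?n - 1) * ?S) + ?n * E)"
      by (simp add: E_def \<kappa>_def add_divide_distrib distrib_left mult_ac)
    \<comment> \<open>The estimate loses in two places here: \<open>?n - 1\<close> is enlarged to
      \<open>?n\<close>, and \<open>E\<close> to \<open>A_fun\<close>.\<close>
    also have "\<dots> \<le> \<omega> c / ?n\<^sup>2 * (\<kappa> * (?n * ?S) + ?n * A_fun val \<gamma> \<sigma> l ?n)"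
      using \<kappa>0 S mpos[of a c] A_fun_ge[OF g l s mpos[of a c], of val] \<omega>[of c]
      by (intro mult_left_mono add_mono mult_right_mono) (auto simp: E_def M_def K_def)
    also have "\<dots> = \<kappa> * (\<omega> c * (?S / ?n)) + \<omega> c * (A_fun val \<gamma> \<sigma> l ?n / ?n)"
      using mpos[of a c] by (simp add: field_simps power2_eq_square)
    finally show "\<omega> c / ?n\<^sup>2 / (1 - l)\<^sup>2 * (l * (2 - l) * ((?n - 1) * ?S) + 6 * l * M\<^sup>2 * ?n * (K * (\<gamma> + noise_term \<gamma> \<sigma> ?n)))
        \<le> (1 / (1 - l)\<^sup>2 - 1) * (\<omega> c * (?S / ?n)) + \<omega> c * (A_fun val \<gamma> \<sigma> l ?n / ?n)"
      unfolding \<kappa> .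
  qed
  also have "\<dots> = (1 / (1 - l)\<^sup>2 - 1) * (\<Sum>a\<in>UNIV. phi cl m val y a)
      + (\<Sum>a\<in>UNIV. \<Sum>c\<in>UNIV. \<omega> c * (A_fun val \<gamma> \<sigma> l (real (m a c)) / real (m a c)))"
    by (simp only: phi_def \<omega>_def[symmetric] sum.distrib sum_distrib_left)
  finally have "\<Delta> \<le> \<dots>" .
  moreover have "0 \<le> \<Delta>"
    unfolding \<Delta> by (intro Bochner_Integration.integral_nonneg V0)
  ultimately show ?thesis by (simp add: \<omega>_def)
qed

end
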